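(* Let $n\ge 1$, $1<p\le q<\infty$ and $0\le\alpha<n$ be such that $\frac1q=\frac1p-\frac{\alpha}{n}$ (that is, $\Theta(\alpha):=\alpha+n(\frac1q-\frac1p)=0$). Let $u,v$ be nonnegative measurable functions on $\mathbb{R}^n$ with $u\in A_\infty(\mathbb{R}^n)$ and $v^{-p'/p}\in A_\infty(\mathbb{R}^n)$, where $\frac1p+\frac1{p'}=1$. Suppose that there exists $C_0>0$ with $$u(x)^{1/q}\le C_0\,v(x)^{1/p}\quad\text{for a.e. }x\in\mathbb{R}^n.$$ Then $$\sup_Q\left(\frac{1}{|Q|}\int_Q u\right)^{1/q}\left(\frac{1}{|Q|}\int_Q v^{-p'/p}\right)^{1/p'}<\infty,$$ and consequently there is a constant $C_1>0$, depending only on $n,p,q,\alpha,[u]_{A_\infty},[v^{-p'/p}]_{A_\infty}$, such that for every measurable $f$: if $0<\alpha<n$, $$\left(\int_{\mathbb{R}^n}|I_\alpha(f)(x)|^q u(x)\,dx\right)^{1/q}\le C_0C_1\left(\int_{\mathbb{R}^n}|f(x)|^p v(x)\,dx\right)^{1/p},$$ and if $\alpha=0$ (so $p=q$), the same inequality holds with $I_\alpha(f)$ replaced by the Hardy--Littlewood maximal function $\mathcal{M}(f)$.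
   Context: $Q$ always denotes a cube in $\mathbb{R}^n$ with sides parallel to the coordinate axes, and suprema over $Q$ are over all such cubes. $I_\alpha(f)(x)=\int_{\mathbb{R}^n}\frac{f(y)}{|x-y|^{n-\alpha}}\,dy$ for $0<\alpha<n$. $\mathcal{M}(f)(x)=\sup_{Q\ni x}\frac1{|Q|}\int_Q|f|$. A weight is a function $w\in L^1_{\rm loc}(\mathbb{R}^n)$ with $w\ge0$ a.e.; $w\in A_\infty(\mathbb{R}^n)$ means $[w]_{A_\infty}:=\sup_Q\left(\frac1{|Q|}\int_Q w\right)\exp\left(-\frac1{|Q|}\int_Q\ln w\right)<\infty$. The weighted inequality is understood as trivially true when its right-hand side is infinite. *)

theory Defs
  imports "HOL-Analysis.Analysis"
begin

text \<open>
  Weights and moduli take values in \<open>[0, \<infinity>]\<close>, so that \<open>v\<close> to a negative power is infinite (and not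
  \<open>0\<close>, as with \<^const>\<open>powr\<close> on the reals) where \<open>v\<close> vanishes, and \<open>ln 0 = -\<infinity>\<close>.
  As usual in integration theory, \<open>0 * \<infinity> = 0\<close> (this is the convention of \<^typ>\<open>ennreal\<close>).
\<close>

definition epowr :: "ennreal \<Rightarrow> real \<Rightarrow> ennreal" where
  "epowr x r =
     (if r = 0 then 1
      else if x = 0 then (if r < 0 then top else 0)
      else if x = top then (if r < 0 then 0 else top)
      else ennreal (enn2real x powr r))"

definition eln :: "ennreal \<Rightarrow> ereal" where
  "eln x = (if x = 0 then - \<infinity> else if x = top then \<infinity> else ereal (ln (enn2real x)))"

definition eexp :: "ereal \<Rightarrow> ennreal" where
  "eexp x = (if x = - \<infinity> then 0 else if x = \<infinity> then top else ennreal (exp (real_of_ereal x)))"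

definition cubes :: "(real ^ 'n) set set" where
  "cubes = {cbox a (\<chi> i. a $ i + l) | a l. 0 < l}"

definition avg :: "(real ^ 'n) set \<Rightarrow> (real ^ 'n \<Rightarrow> ennreal) \<Rightarrow> ennreal" where
  "avg Q w = (\<integral>\<^sup>+x\<in>Q. w x \<partial>lebesgue) / emeasure lebesgue Q"

text \<open>
  The average of \<open>ln w\<close> as an extended real: the integral of the positive part minus that of the
  negative part (\<^const>\<open>e2ennreal\<close> truncates negative values to \<open>0\<close>).  For locally integrable \<open>w\<close> the
  first one is finite, so the difference is always meaningful, with possible value \<open>-\<infinity>\<close>.
\<close>

definition ln_avg :: "(real ^ 'n) set \<Rightarrow> (real ^ 'n \<Rightarrow> ennreal) \<Rightarrow> ereal" where
  "ln_avg Q w =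
     (enn2ereal (\<integral>\<^sup>+x\<in>Q. e2ennreal (eln (w x)) \<partial>lebesgue)
        - enn2ereal (\<integral>\<^sup>+x\<in>Q. e2ennreal (- eln (w x)) \<partial>lebesgue)) / ereal (measure lebesgue Q)"

definition weight :: "(real ^ 'n \<Rightarrow> ennreal) \<Rightarrow> bool" where
  "weight w \<longleftrightarrow> w \<in> borel_measurable lebesgue
     \<and> (\<forall>K. compact K \<longrightarrow> (\<integral>\<^sup>+x\<in>K. w x \<partial>lebesgue) < top)"

definition A_inf_const :: "(real ^ 'n \<Rightarrow> ennreal) \<Rightarrow> ennreal" where
  "A_inf_const w = (SUP Q\<in>cubes. avg Q w * eexp (- ln_avg Q w))"

definition A_inf :: "(real ^ 'n \<Rightarrow> ennreal) set" where
  "A_inf = {w. weight w \<and> A_inf_const w < top}"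

definition riesz_integrand :: "real \<Rightarrow> (real ^ 'n \<Rightarrow> complex) \<Rightarrow> real ^ 'n \<Rightarrow> real ^ 'n \<Rightarrow> complex" where
  "riesz_integrand \<alpha> f x y = f y / complex_of_real (norm (x - y) powr (real CARD('n) - \<alpha>))"

definition riesz_potential :: "real \<Rightarrow> (real ^ 'n \<Rightarrow> complex) \<Rightarrow> real ^ 'n \<Rightarrow> complex" where
  "riesz_potential \<alpha> f x = (\<integral>y. riesz_integrand \<alpha> f x y \<partial>lebesgue)"

text \<open>
  The modulus of the Riesz potential, set to \<open>\<infinity>\<close> where the defining integral does not converge
  absolutely (the Bochner integral would be \<open>0\<close> there).  For \<open>f \<ge> 0\<close> this is the \<open>[0, \<infinity>]\<close>-valued
  integral, and in general a finite weighted norm forces absolute convergence almost everywhere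
  on the set where the weight is positive.
\<close>

definition riesz_modulus :: "real \<Rightarrow> (real ^ 'n \<Rightarrow> complex) \<Rightarrow> real ^ 'n \<Rightarrow> ennreal" where
  "riesz_modulus \<alpha> f x =
     (if integrable lebesgue (riesz_integrand \<alpha> f x)
      then ennreal (cmod (riesz_potential \<alpha> f x)) else top)"

definition maximal :: "(real ^ 'n \<Rightarrow> complex) \<Rightarrow> real ^ 'n \<Rightarrow> ennreal" where
  "maximal f x = (SUP Q\<in>{Q \<in> cubes. x \<in> Q}. avg Q (\<lambda>y. ennreal (cmod (f y))))"

definition weighted_norm :: "real \<Rightarrow> (real ^ 'n \<Rightarrow> ennreal) \<Rightarrow> (real ^ 'n \<Rightarrow> ennreal) \<Rightarrow> ennreal" where
  "weighted_norm r w g = epowr (\<integral>\<^sup>+x. epowr (g x) r * w x \<partial>lebesgue) (1 / r)"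

end

theory Submission
  imports Defs
begin

text \<open>
  An \<open>A\<^sub>\<infinity>\<close> weight \<open>w\<close> is, on each cube or ball, at least a fixed multiple of its average outside a small
  portion of the set.  For \<open>u\<close> and \<open>\<sigma> = v\<^bsup>-p'/p\<^esup>\<close> both bounds hold at a common point, where the
  pointwise hypothesis turns them into the two-weight condition on averages.  The same property makes
  \<open>u\<close> and \<open>\<sigma>\<close> doubling, with \<open>u(2B) \<ge> (1 + \<epsilon>) u(B)\<close>, and gives
  \<open>u(B)\<^bsup>1/p\<^esup> \<sigma>(B)\<^bsup>1/p'\<^esup> \<le> C \<integral>\<^sub>B u\<^bsup>1/p\<^esup> \<sigma>\<^bsup>1/p'\<^esup>\<close>.

  Write \<open>|f| = g \<sigma>\<close>, let \<open>m\<^sub>B\<close> be the \<open>\<sigma>\<close>-average of \<open>g\<close> over \<open>B\<close>, and \<open>h = (M\<^sub>\<sigma> g)\<^bsup>p-1\<^esup> (\<sigma>/u)\<^bsup>1/p'\<^esup>\<close>.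
  Then \<open>m\<^sub>B \<sigma>(B)\<^bsup>1/p\<^esup>\<close> is at most \<open>G = \<parallel>M\<^sub>\<sigma> g\<parallel>\<close> in \<open>L\<^sup>p(\<sigma>)\<close> and also at most
  \<open>C (M\<^sub>u h(x))\<^bsup>1/(p-1)\<^esup> u(B)\<^bsup>1/p\<^esup>\<close> for \<open>x \<in> B\<close>, where
  \<open>\<integral> (M\<^sub>u h)\<^bsup>p'\<^esup> u \<le> C \<integral> h\<^bsup>p'\<^esup> u \<le> C G\<^sup>p \<le> C' \<integral> g\<^sup>p \<sigma> = C' \<integral> |f|\<^sup>p v\<close>.
  Together with the two-weight condition these two bounds control \<open>|f|\<close> on balls around \<open>x\<close>.  Summing
  over dyadic shells as in Hedberg's argument, with the shells measured by \<open>u\<close>, bounds the Riesz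
  potential at \<open>x\<close> by \<open>C G\<^bsup>1-p/q\<^esup> (M\<^sub>u h(x))\<^bsup>p'/q\<^esup>\<close>; for \<open>\<alpha> = 0\<close> the second bound alone
  controls the maximal function.
\<close>

section \<open>Maximal functions for doubling measures\<close>

lemma epowr_zero [simp]: "0 < r \<Longrightarrow> epowr 0 r = 0"
  and epowr_top [simp]: "0 < r \<Longrightarrow> epowr top r = top"
  and epowr_one [simp]: "epowr x 1 = x"
  by (auto simp: epowr_def enn2real_nonneg ennreal_enn2real_if)

lemma epowr_ennreal: "0 < r \<Longrightarrow> 0 \<le> x \<Longrightarrow> epowr (ennreal x) r = ennreal (x powr r)"
  by (auto simp: epowr_def)

lemma epowr_ennreal_pos: "0 < x \<Longrightarrow> epowr (ennreal x) r = ennreal (x powr r)"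
  by (auto simp: epowr_def)

lemma epowr_mono: "0 < r \<Longrightarrow> x \<le> y \<Longrightarrow> epowr x r \<le> epowr y r"
  by (cases x; cases y) (auto simp: epowr_ennreal powr_mono2 top_unique)

lemma epowr_mult: "0 < r \<Longrightarrow> epowr (x * y) r = epowr x r * epowr y r"
  by (cases x; cases y)
    (auto simp: epowr_ennreal powr_mult ennreal_mult_top ennreal_top_mult
      simp flip: ennreal_mult)

lemma epowr_epowr: "0 < r \<Longrightarrow> 0 < s \<Longrightarrow> epowr (epowr x r) s = epowr x (r * s)"
  by (cases x) (auto simp: epowr_ennreal powr_powr)

lemma epowr_eq_0_iff [simp]: "0 < r \<Longrightarrow> epowr x r = 0 \<longleftrightarrow> x = 0"
  by (cases x) (auto simp: epowr_ennreal)

lemma epowr_eq_top_iff [simp]: "0 < r \<Longrightarrow> epowr x r = top \<longleftrightarrow> x = top"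
  by (cases x) (auto simp: epowr_ennreal)

lemma epowr_measurable [measurable]:
  assumes [measurable]: "f \<in> borel_measurable M"
  shows "(\<lambda>x. epowr (f x) r) \<in> borel_measurable M"
  unfolding epowr_def by measurable

text \<open>The balls only have to contain the point, so superlevel sets are unions of open balls.
  This yields measurability of the maximal function for every \<open>h\<close>.\<close>

definition max_op :: "'a::metric_space measure \<Rightarrow> ('a \<Rightarrow> ennreal) \<Rightarrow> 'a \<Rightarrow> ennreal" where
  "max_op \<mu> h x = (SUP (c, r)\<in>{(c, r). 0 < r \<and> dist c x < r}.
     (\<integral>\<^sup>+y\<in>ball c r. h y \<partial>\<mu>) / emeasure \<mu> (ball c r))"

lemma max_op_upper:
  "0 < r \<Longrightarrow> x \<in> ball c r \<Longrightarrow> (\<integral>\<^sup>+y\<in>ball c r. h y \<partial>\<mu>) / emeasure \<mu> (ball c r) \<le> max_op \<mu> h x"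
  unfolding max_op_def by (rule SUP_upper2[where i="(c, r)"]) auto

lemma less_max_op_iff:
  "z < max_op \<mu> h x \<longleftrightarrow>
     (\<exists>c r. 0 < r \<and> x \<in> ball c r \<and> z < (\<integral>\<^sup>+y\<in>ball c r. h y \<partial>\<mu>) / emeasure \<mu> (ball c r))"
  unfolding max_op_def by (auto simp: less_SUP_iff)

lemma open_max_op_greater: "open {x. z < max_op \<mu> h x}"
proof -
  have "{x. z < max_op \<mu> h x} =
    (\<Union>(c, r)\<in>{(c, r). 0 < r \<and> z < (\<integral>\<^sup>+y\<in>ball c r. h y \<partial>\<mu>) / emeasure \<mu> (ball c r)}. ball c r)"
    by (auto simp: less_max_op_iff) blast
  also have "open \<dots>" by auto
  finally show ?thesis .
qed

text \<open>Vitali's greedy selection: keep a ball of largest radius and discard every ball that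
  meets it. A discarded ball is no larger, so it lies in the threefold dilation of the kept one.
  Recursion treats the rest.\<close>

lemma finite_ball_family_disjoint:
  fixes I :: "('a::metric_space \<times> real) set"
  assumes "finite I"
  obtains J where "J \<subseteq> I" "disjoint_family_on (\<lambda>(c, r). ball c r) J"
    "(\<Union>(c, r)\<in>I. ball c r) \<subseteq> (\<Union>(c, r)\<in>J. ball c (3 * r))"
proof -
  have "\<exists>J\<subseteq>I. disjoint_family_on (\<lambda>(c, r). ball c r) J \<and>
    (\<Union>(c, r)\<in>I. ball c r) \<subseteq> (\<Union>(c, r)\<in>J. ball c (3 * r))"
    using assms
  proof (induction rule: finite_psubset_induct)
    case (psubset I)
    show ?case
    proof (cases "I = {}")
      case False
      then have "Max (snd ` I) \<in> snd ` I"
        using psubset.hyps by (intro Max_in) auto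
      then obtain i where i: "i \<in> I" "snd i = Max (snd ` I)" by auto
      then have i_max: "snd j \<le> snd i" if "j \<in> I" for j
        using that psubset.hyps by simp
      \<comment> \<open>A ball of nonpositive radius is empty and does not meet even itself, so
        \<open>i\<close> is removed explicitly to make \<open>I'\<close> a proper subset.\<close>
      define I' where "I' = {j \<in> I. ball (fst j) (snd j) \<inter> ball (fst i) (snd i) = {}} - {i}"
      have "I' \<subset> I" unfolding I'_def using i(1) by auto
      from psubset.IH[OF this] obtain J where J: "J \<subseteq> I'" "disjoint_family_on (\<lambda>(c, r). ball c r) J"
        "(\<Union>(c, r)\<in>I'. ball c r) \<subseteq> (\<Union>(c, r)\<in>J. ball c (3 * r))" by blast
      have dis: "ball (fst j) (snd j) \<inter> ball (fst i) (snd i) = {}" if "j \<in> J" for j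
        using that J(1) unfolding I'_def by auto
      have "disjoint_family_on (\<lambda>(c, r). ball c r) (insert i J)"
        using J(2) dis unfolding disjoint_family_on_def split_def by blast
      moreover have "(\<Union>(c, r)\<in>I. ball c r) \<subseteq> (\<Union>(c, r)\<in>insert i J. ball c (3 * r))"
      proof
        fix x assume "x \<in> (\<Union>(c, r)\<in>I. ball c r)"
        then obtain j where j: "j \<in> I" "x \<in> ball (fst j) (snd j)" by auto
        show "x \<in> (\<Union>(c, r)\<in>insert i J. ball c (3 * r))"
        proof (cases "j \<in> I'")
          case True
          then have "x \<in> (\<Union>(c, r)\<in>I'. ball c r)" using j(2) by (force simp: split_def)
          then show ?thesis using J(3) by blast
        next
          case F: False
          have "x \<in> ball (fst i) (3 * snd i)"
          proof -
            obtain y where y: "y \<in> ball (fst j) (snd j)" "y \<in> ball (fst i) (snd i)"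
              using F j unfolding I'_def by (cases "j = i") auto
            have "dist (fst i) x \<le> dist (fst i) y + dist (fst j) y + dist (fst j) x"
              using dist_triangle[of "fst i" x y] dist_triangle2[of y x "fst j"]
              by (simp add: dist_commute)
            also have "\<dots> < 3 * snd i"
              using y j(2) i_max[OF j(1)] by simp
            finally show ?thesis by simp
          qed
          then show ?thesis by (auto simp: split_def)
        qed
      qed
      moreover have "insert i J \<subseteq> I" using J(1) i(1) unfolding I'_def by auto
      ultimately show ?thesis by blast
    qed (auto simp: disjoint_family_on_def)
  qed
  then show ?thesis using that by blast
qed

text \<open>The factor 3 is the dilation produced by \<open>finite_ball_family_disjoint\<close>. The
  \<sigma>-algebra may be larger than the Borel one, which admits densities with respect to
  completed Lebesgue measure.\<close>

locale doubling_measure =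
  fixes \<mu> :: "'a::{metric_space, second_countable_topology} measure" and D :: real
  assumes borel_sets: "sets borel \<subseteq> sets \<mu>"
    and D_nonneg: "0 \<le> D"
    and ball_pos: "0 < r \<Longrightarrow> 0 < emeasure \<mu> (ball x r)"
    and ball_finite: "emeasure \<mu> (ball x r) < top"
    and doubling: "0 < r \<Longrightarrow> emeasure \<mu> (ball x (3 * r)) \<le> ennreal D * emeasure \<mu> (ball x r)"
begin

lemma open_in_sets: "open S \<Longrightarrow> S \<in> sets \<mu>"
  using borel_sets by auto

lemma space_UNIV [simp]: "space \<mu> = UNIV"
  using open_in_sets[of UNIV] sets.sets_into_space by auto

lemma ball_in_sets [measurable]: "ball x r \<in> sets \<mu>"
  by (simp add: open_in_sets)

lemma max_op_measurable [measurable]: "max_op \<mu> h \<in> borel_measurable \<mu>"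
  by (rule borel_measurableI_greater) (simp add: open_in_sets open_max_op_greater)

text \<open>The superlevel set is the union of the balls whose average exceeds \<open>z\<close>. For
  finitely many of them, a disjoint subfamily with threefold dilations covering the union gives the
  bound by doubling. Lindelof's theorem supplies a countable subfamily with the same union, and
  continuity from below passes from its finite parts to the whole.\<close>

lemma max_op_weak_type:
  assumes [measurable]: "h \<in> borel_measurable \<mu>"
  shows "z * emeasure \<mu> {x. z < max_op \<mu> h x} \<le> ennreal D * (\<integral>\<^sup>+x. h x \<partial>\<mu>)"
proof -
  define I where "I = {(c, r). 0 < r \<and> z < (\<integral>\<^sup>+y\<in>ball c r. h y \<partial>\<mu>) / emeasure \<mu> (ball c r)}"
  have ball_le: "z * emeasure \<mu> (ball c r) \<le> (\<integral>\<^sup>+y\<in>ball c r. h y \<partial>\<mu>)" if "(c, r) \<in> I" for c r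
  proof -
    have "z * emeasure \<mu> (ball c r)
        \<le> (\<integral>\<^sup>+y\<in>ball c r. h y \<partial>\<mu>) / emeasure \<mu> (ball c r) * emeasure \<mu> (ball c r)"
      using that unfolding I_def by (intro mult_right_mono) auto
    also have "\<dots> = (\<integral>\<^sup>+y\<in>ball c r. h y \<partial>\<mu>)"
      using that ball_pos[of r c] ball_finite[of c r] unfolding I_def
      by (simp add: ennreal_divide_times)
    finally show ?thesis .
  qed
  have fin: "z * emeasure \<mu> (\<Union>(c, r)\<in>F. ball c r) \<le> ennreal D * (\<integral>\<^sup>+x. h x \<partial>\<mu>)"
    if "finite F" "F \<subseteq> I" for F
  proof -
    obtain J where J: "J \<subseteq> F" "disjoint_family_on (\<lambda>(c, r). ball c r) J"
      "(\<Union>(c, r)\<in>F. ball c r) \<subseteq> (\<Union>(c, r)\<in>J. ball c (3 * r))"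
      using finite_ball_family_disjoint[OF \<open>finite F\<close>] by metis
    have "finite J" using J(1) \<open>finite F\<close> finite_subset by blast
    have "z * emeasure \<mu> (\<Union>(c, r)\<in>F. ball c r) \<le> z * emeasure \<mu> (\<Union>(c, r)\<in>J. ball c (3 * r))"
      by (intro mult_left_mono emeasure_mono J open_in_sets) (auto simp: split_def)
    also have "\<dots> \<le> z * (\<Sum>(c, r)\<in>J. emeasure \<mu> (ball c (3 * r)))"
      using \<open>finite J\<close> unfolding split_def
      by (intro mult_left_mono emeasure_subadditive_finite) auto
    also have "\<dots> \<le> z * (\<Sum>(c, r)\<in>J. ennreal D * emeasure \<mu> (ball c r))"
      using J(1) that unfolding I_def
      by (intro mult_left_mono sum_mono) (auto intro!: doubling)
    also have "\<dots> = ennreal D * (\<Sum>(c, r)\<in>J. z * emeasure \<mu> (ball c r))"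
      by (simp add: sum_distrib_left split_def mult_ac)
    also have "\<dots> \<le> ennreal D * (\<Sum>(c, r)\<in>J. \<integral>\<^sup>+y\<in>ball c r. h y \<partial>\<mu>)"
      using J(1) that by (intro mult_left_mono sum_mono) (auto intro!: ball_le)
    also have "(\<Sum>(c, r)\<in>J. \<integral>\<^sup>+y\<in>ball c r. h y \<partial>\<mu>) =
        (\<integral>\<^sup>+y. (\<Sum>(c, r)\<in>J. h y * indicator (ball c r) y) \<partial>\<mu>)"
      unfolding split_def by (rule nn_integral_sum[symmetric]) simp
    also have "\<dots> \<le> (\<integral>\<^sup>+y. h y \<partial>\<mu>)"
    proof (rule nn_integral_mono)
      fix y
      have "(\<Sum>(c, r)\<in>J. indicator (ball c r) y) = (indicator (\<Union>(c, r)\<in>J. ball c r) y :: ennreal)"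
        using indicator_UN_disjoint[OF \<open>finite J\<close> J(2), of y, where ?'c = ennreal] by (simp add: split_def)
      then have "(\<Sum>(c, r)\<in>J. h y * indicator (ball c r) y)
          = h y * indicator (\<Union>(c, r)\<in>J. ball c r) y"
        by (simp add: split_def flip: sum_distrib_left)
      then show "(\<Sum>(c, r)\<in>J. h y * indicator (ball c r) y) \<le> h y"
        by (simp split: split_indicator)
    qed
    finally show ?thesis by (simp add: mult_left_mono)
  qed
  have eq: "{x. z < max_op \<mu> h x} = (\<Union>(c, r)\<in>I. ball c r)"
    unfolding I_def by (auto simp: less_max_op_iff) blast
  obtain I' where I': "I' \<subseteq> I" "countable I'" "(\<Union>(c, r)\<in>I'. ball c r) = (\<Union>(c, r)\<in>I. ball c r)"
  proof -
    obtain \<F> where F: "\<F> \<subseteq> (\<lambda>(c, r). ball c r) ` I" "countable \<F>" "\<Union>\<F> = \<Union>((\<lambda>(c, r). ball c r) ` I)"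
      using Lindelof[of "(\<lambda>(c, r). ball c r) ` I"] by (auto simp: split_def)
    then obtain I' where "I' \<subseteq> I" "countable I'" "\<F> = (\<lambda>(c, r). ball c r) ` I'"
      by (meson countable_subset_image)
    with F(3) show ?thesis using that by metis
  qed
  show ?thesis
  proof (cases "I' = {}")
    case True
    then show ?thesis using eq I'(3) by simp
  next
    case False
    define A where "A n = (\<Union>i\<in>{0..<n}. case from_nat_into I' i of (c, r) \<Rightarrow> ball c r)" for n
    have A_sets: "range A \<subseteq> sets \<mu>" unfolding A_def by (auto simp: split_def)
    have "(\<Union>n. A n) = (\<Union>(c, r)\<in>I'. ball c r)"
    proof -
      have "(\<Union>n. A n) = (\<Union>i. case from_nat_into I' i of (c, r) \<Rightarrow> ball c r)"
        unfolding A_def by (rule UN_UN_finite_eq)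
      also have "\<dots> = (\<Union>(c, r)\<in>range (from_nat_into I'). ball c r)" by auto
      finally show ?thesis using range_from_nat_into[OF False I'(2)] by simp
    qed
    moreover have "incseq A" unfolding A_def incseq_def by (intro allI impI UN_mono) auto
    ultimately have "emeasure \<mu> {x. z < max_op \<mu> h x} = (SUP n. emeasure \<mu> (A n))"
      using SUP_emeasure_incseq[OF A_sets] eq I'(3) by simp
    then have "z * emeasure \<mu> {x. z < max_op \<mu> h x} = (SUP n. z * emeasure \<mu> (A n))"
      by (simp add: SUP_mult_left_ennreal)
    also have "\<dots> \<le> ennreal D * (\<integral>\<^sup>+x. h x \<partial>\<mu>)"
    proof (rule SUP_least)
      fix n
      have "A n = (\<Union>(c, r)\<in>from_nat_into I' ` {0..<n}. ball c r)"
        unfolding A_def by simp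
      then show "z * emeasure \<mu> (A n) \<le> ennreal D * (\<integral>\<^sup>+x. h x \<partial>\<mu>)"
        using fin[of "from_nat_into I' ` {0..<n}"] I'(1) from_nat_into[OF False] by auto
    qed
    finally show ?thesis .
  qed
qed

lemma max_op_le_add_const:
  assumes [measurable]: "h' \<in> borel_measurable \<mu>" and le: "\<And>x. h x \<le> h' x + z"
  shows "max_op \<mu> h x \<le> max_op \<mu> h' x + z"
proof -
  have "(\<integral>\<^sup>+y\<in>ball c r. h y \<partial>\<mu>) / emeasure \<mu> (ball c r) \<le> max_op \<mu> h' x + z"
    if "0 < r" "x \<in> ball c r" for c r
  proof -
    have "(\<integral>\<^sup>+y\<in>ball c r. h y \<partial>\<mu>) \<le> (\<integral>\<^sup>+y. h' y * indicator (ball c r) y + z * indicator (ball c r) y \<partial>\<mu>)"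
      using le by (intro nn_integral_mono) (auto split: split_indicator)
    also have "\<dots> = (\<integral>\<^sup>+y\<in>ball c r. h' y \<partial>\<mu>) + z * emeasure \<mu> (ball c r)"
      by (subst nn_integral_add) (auto simp: nn_integral_cmult_indicator)
    finally have "(\<integral>\<^sup>+y\<in>ball c r. h y \<partial>\<mu>) / emeasure \<mu> (ball c r)
      \<le> ((\<integral>\<^sup>+y\<in>ball c r. h' y \<partial>\<mu>) + z * emeasure \<mu> (ball c r)) / emeasure \<mu> (ball c r)"
      by (rule divide_right_mono_ennreal)
    also have "\<dots> = (\<integral>\<^sup>+y\<in>ball c r. h' y \<partial>\<mu>) / emeasure \<mu> (ball c r) + z"
      using ball_pos[OF that(1), of c] ball_finite[of c r]
      by (simp add: add_divide_distrib_ennreal ennreal_mult_divide_eq)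
    also have "\<dots> \<le> max_op \<mu> h' x + z"
      by (intro add_right_mono max_op_upper that)
    finally show ?thesis .
  qed
  then show ?thesis
    unfolding max_op_def[of _ h] by (intro SUP_least) auto
qed


text \<open>Cutting off the values of \<open>h\<close> up to half the level lowers the maximal
  function by at most that half level, so the weak type inequality can be applied to the truncated
  function. The truncation leaves, for each value of \<open>h\<close>, only the levels below roughly
  twice that value.\<close>

lemma max_op_level:
  fixes k :: int
  assumes [measurable]: "h \<in> borel_measurable \<mu>"
  shows "emeasure \<mu> {x. ennreal (2 powr k) < max_op \<mu> h x}
    \<le> ennreal (D * 2 powr (1 - k)) * (\<integral>\<^sup>+x. (if ennreal (2 powr (k - 1)) < h x then h x else 0) \<partial>\<mu>)"
proof -
  define z where "z = ennreal (2 powr (k - 1))"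
  define h' where "h' x = (if z < h x then h x else 0)" for x
  have [measurable]: "h' \<in> borel_measurable \<mu>" unfolding h'_def by measurable
  have zz: "ennreal (2 powr k) = z + z"
    unfolding z_def by (simp flip: ennreal_plus) (simp add: powr_diff)
  have "{x. ennreal (2 powr k) < max_op \<mu> h x} \<subseteq> {x. z < max_op \<mu> h' x}"
  proof safe
    fix x assume "ennreal (2 powr k) < max_op \<mu> h x"
    moreover have "max_op \<mu> h x \<le> max_op \<mu> h' x + z"
      by (rule max_op_le_add_const) (auto simp: h'_def)
    ultimately have "z + z < max_op \<mu> h' x + z" unfolding zz by order
    then show "z < max_op \<mu> h' x" by (metis add_right_mono not_le)
  qed
  then have "emeasure \<mu> {x. ennreal (2 powr k) < max_op \<mu> h x} \<le> emeasure \<mu> {x. z < max_op \<mu> h' x}"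
    by (intro emeasure_mono) (auto simp: open_in_sets open_max_op_greater)
  also have "\<dots> = ennreal (2 powr (1 - k)) * (z * emeasure \<mu> {x. z < max_op \<mu> h' x})"
  proof -
    have "ennreal (2 powr (1 - k)) * z = 1"
      unfolding z_def by (simp flip: ennreal_mult powr_add)
    then show ?thesis by (simp flip: mult.assoc)
  qed
  also have "\<dots> \<le> ennreal (2 powr (1 - k)) * (ennreal D * (\<integral>\<^sup>+x. h' x \<partial>\<mu>))"
    by (intro mult_left_mono max_op_weak_type) auto
  also have "\<dots> = ennreal (D * 2 powr (1 - k)) * (\<integral>\<^sup>+x. h' x \<partial>\<mu>)"
    using D_nonneg by (simp add: ennreal_mult mult_ac)
  finally show ?thesis unfolding h'_def z_def .
qed

end

section \<open>Dyadic layers and the strong type inequality\<close>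

lemma ennreal_unbounded_top:
  assumes "\<And>B. 0 < B \<Longrightarrow> ennreal B \<le> x"
  shows "top \<le> x"
proof (cases x)
  case (real t)
  then show ?thesis using assms[of "t + 1"] by simp
qed simp

lemma dyadic_level_ex:
  fixes y :: real
  assumes "0 < y"
  obtains k :: int where "2 powr k < y" "y \<le> 2 powr (k + 1)"
proof -
  define k where "k = \<lceil>log 2 y\<rceil> - 1"
  have "real_of_int k < log 2 y" "log 2 y \<le> k + 1" unfolding k_def by linarith+
  then show ?thesis
    using that[of k] assms by (simp add: less_log_iff log_le_iff)
qed

text \<open>For finite \<open>y\<close> the one term with 2^k < y \<le> 2^(k+1) suffices; for
  infinite \<open>y\<close> all terms occur and they are unbounded. The sum over the integers is an
  integral over counting measure, so that Tonelli's theorem can exchange it with the integral over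
  the space.\<close>

lemma epowr_le_dyadic_sum:
  fixes p :: real
  assumes p: "0 < p"
  shows "epowr y p \<le> (\<integral>\<^sup>+k. (if ennreal (2 powr real_of_int k) < y then ennreal (2 powr ((k + 1) * p)) else 0)
    \<partial>count_space (UNIV :: int set))"
proof (cases y)
  case (real t)
  show ?thesis
  proof (cases "t = 0")
    case True then show ?thesis using real p by simp
  next
    case False
    then obtain k :: int where k: "2 powr k < t" "t \<le> 2 powr (k + 1)"
      using dyadic_level_ex[of t] real by auto
    have "t powr p \<le> (2 powr (k + 1)) powr p"
      using k real p by (intro powr_mono2) auto
    then have "epowr y p \<le> (if ennreal (2 powr real_of_int k) < y then ennreal (2 powr ((k + 1) * p)) else 0)"
      using k real p by (auto simp: epowr_ennreal powr_powr ennreal_less_iff intro!: ennreal_leI)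
    also have "\<dots> \<le> (\<integral>\<^sup>+k. (if ennreal (2 powr real_of_int k) < y then ennreal (2 powr ((k + 1) * p)) else 0)
      \<partial>count_space (UNIV :: int set))"
      by (rule nn_integral_ge_point) simp
    finally show ?thesis .
  qed
next
  case top
  have "ennreal B \<le> (\<integral>\<^sup>+k. (if ennreal (2 powr real_of_int k) < y then ennreal (2 powr ((k + 1) * p)) else 0)
    \<partial>count_space (UNIV :: int set))" if "0 < B" for B
  proof -
    define k where "k = \<lceil>log 2 B / p\<rceil>"
    have "log 2 B / p \<le> k + 1" unfolding k_def by linarith
    then have "log 2 B \<le> (k + 1) * p" using p by (simp add: field_simps)
    then have "B \<le> 2 powr ((k + 1) * p)" using that by (simp add: log_le_iff)
    then have "ennreal B \<le> (if ennreal (2 powr real_of_int k) < y then ennreal (2 powr ((k + 1) * p)) else 0)"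
      using top by (auto intro: ennreal_leI)
    also have "\<dots> \<le> (\<integral>\<^sup>+k. (if ennreal (2 powr real_of_int k) < y then ennreal (2 powr ((k + 1) * p)) else 0)
      \<partial>count_space (UNIV :: int set))"
      by (rule nn_integral_ge_point) simp
    finally show ?thesis .
  qed
  then have "top \<le> (\<integral>\<^sup>+k. (if ennreal (2 powr real_of_int k) < y then ennreal (2 powr ((k + 1) * p)) else 0)
    \<partial>count_space (UNIV :: int set))"
    by (metis (no_types, lifting) ennreal_unbounded_top)
  then show ?thesis by (simp add: top_unique)
qed

text \<open>If \<open>m\<close> is the dyadic level of \<open>y\<close>, only k \<le> m + 1
  contributes. Read downwards from \<open>m + 1\<close>, the terms form a geometric series with
  ratio 2^(1-p), which is below 1 because p > 1, and its first term is at most 4^p times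
  y^p.\<close>

lemma dyadic_sum_le_epowr:
  fixes p :: real
  assumes p: "1 < p"
  shows "(\<integral>\<^sup>+k. (if ennreal (2 powr (real_of_int k - 1)) < y
      then ennreal (2 powr ((k + 1) * p) * 2 powr (1 - k)) * y else 0) \<partial>count_space (UNIV :: int set))
    \<le> ennreal (4 powr p / (1 - 2 powr (1 - p))) * epowr y p"
proof (cases y)
  case (real t)
  show ?thesis
  proof (cases "t = 0")
    case True then show ?thesis using real by simp
  next
    case False
    then have t: "0 < t" using real by simp
    then obtain m :: int where m: "2 powr m < t" "t \<le> 2 powr (m + 1)"
      using dyadic_level_ex[of t] by auto
    have lt_iff: "2 powr (real_of_int k - 1) < t \<longleftrightarrow> k \<le> m + 1" for k :: int
    proof
      assume "2 powr (real_of_int k - 1) < t"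
      then have "(2::real) powr (real_of_int k - 1) < 2 powr (m + 1)" using m by linarith
      then have "real_of_int k - 1 < m + 1" by simp
      then show "k \<le> m + 1" by linarith
    next
      assume "k \<le> m + 1"
      then have "(2::real) powr (real_of_int k - 1) \<le> 2 powr m" by simp
      then show "2 powr (real_of_int k - 1) < t" using m by linarith
    qed
    define c where "c = 2 powr (1 - p)"
    have c: "0 < c" "c < 1" using p powr_less_mono[of "1 - p" 0 2] unfolding c_def by auto
    have "(\<integral>\<^sup>+k. (if ennreal (2 powr (real_of_int k - 1)) < y
        then ennreal (2 powr ((k + 1) * p) * 2 powr (1 - k)) * y else 0) \<partial>count_space (UNIV :: int set))
      = (\<integral>\<^sup>+k. ennreal (2 powr ((real_of_int k + 1) * p) * 2 powr (1 - k) * t)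
            * indicator {..m + 1} k \<partial>count_space UNIV)"
      using real by (intro nn_integral_cong) (auto simp: ennreal_less_iff lt_iff ennreal_mult[symmetric])
    also have "\<dots> = (\<integral>\<^sup>+k. ennreal (2 powr ((real_of_int k + 1) * p) * 2 powr (1 - k) * t)
        \<partial>count_space {..m + 1})"
      by (simp add: nn_integral_count_space_indicator)
    also have "\<dots> = (\<integral>\<^sup>+i. ennreal (2 powr ((real_of_int (m + 1 - int i) + 1) * p)
          * 2 powr real_of_int (1 - (m + 1 - int i)) * t) \<partial>count_space UNIV)"
    proof (rule nn_integral_bij_count_space[symmetric,
        where f="\<lambda>k. ennreal (2 powr ((real_of_int k + 1) * p) * 2 powr real_of_int (1 - k) * t)"])
      show "bij_betw (\<lambda>i. m + 1 - int i) UNIV {..m + 1}"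
        by (rule bij_betw_byWitness[where f'="\<lambda>k. nat (m + 1 - k)"]) auto
    qed
    also have "\<dots> = (\<Sum>i. ennreal (2 powr ((real_of_int m + 2) * p - m) * t) * ennreal (c ^ i))"
    proof -
      have "2 powr ((real_of_int (m + 1 - int i) + 1) * p) * 2 powr real_of_int (1 - (m + 1 - int i)) * t
        = (2 powr ((real_of_int m + 2) * p - m) * t) * c ^ i" for i
        unfolding c_def using t
        by (simp add: powr_realpow[symmetric] powr_powr powr_add[symmetric]) (simp add: algebra_simps)
      then show ?thesis using t c
        by (simp only: nn_integral_count_space_nat) (simp add: ennreal_mult'' del: ennreal_suminf_cmult)
    qed
    also have "\<dots> = ennreal (2 powr ((real_of_int m + 2) * p - m) * t) * ennreal (1 / (1 - c))"
    proof -
      have "(\<lambda>i. c ^ i) sums (1 / (1 - c))" using c by (intro geometric_sums) simp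
      then have "(\<Sum>i. ennreal (c ^ i)) = ennreal (1 / (1 - c))"
        using c by (intro suminf_ennreal_eq) simp_all
      then show ?thesis unfolding ennreal_suminf_cmult by (rule arg_cong)
    qed
    also have "\<dots> = ennreal (4 powr p * (2 powr m) powr (p - 1) * t / (1 - c))"
    proof -
      have "2 powr ((real_of_int m + 2) * p - m) = 4 powr p * (2 powr m) powr (p - 1)"
      proof -
        have "(4::real) powr p = 2 powr (2 * p)" by (simp add: powr_powr[symmetric])
        then show ?thesis by (simp add: powr_powr flip: powr_add) (simp add: algebra_simps)
      qed
      then show ?thesis using t c by (simp flip: ennreal_mult)
    qed
    also have "\<dots> \<le> ennreal (4 powr p * t powr (p - 1) * t / (1 - c))"
      using m t c p
      by (intro ennreal_leI divide_right_mono mult_right_mono mult_left_mono powr_mono2) auto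
    also have "\<dots> = ennreal (4 powr p / (1 - c)) * epowr y p"
      using real t p c by (simp add: epowr_ennreal powr_diff flip: ennreal_mult)
    finally show ?thesis unfolding c_def .
  qed
next
  case top
  \<comment> \<open>This makes the constant positive, so the right-hand side is infinite.\<close>
  have "2 powr (1 - p) < (1::real)" using p powr_less_mono[of "1 - p" 0 2] by auto
  then show ?thesis using top p by (simp add: ennreal_mult_top)
qed

text \<open>\<open>D\<close> enters through the weak type inequality, the other factor through the
  geometric series in \<open>dyadic_sum_le_epowr\<close>. The value blows up as \<open>p\<close>
  tends to 1.\<close>

definition max_const :: "real \<Rightarrow> real \<Rightarrow> real" where
  "max_const D p = D * (4 powr p / (1 - 2 powr (1 - p)))"

text \<open>Marcinkiewicz interpolation in discrete form: split the power into dyadic levels,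
  exchange sum and integral, estimate each level by the truncated weak type inequality, exchange
  back, and sum the geometric series pointwise.\<close>

lemma (in doubling_measure) max_op_strong_type:
  assumes p: "1 < p" and [measurable]: "h \<in> borel_measurable \<mu>"
  shows "(\<integral>\<^sup>+x. epowr (max_op \<mu> h x) p \<partial>\<mu>) \<le> ennreal (max_const D p) * (\<integral>\<^sup>+x. epowr (h x) p \<partial>\<mu>)"
proof -
  let ?W = "\<lambda>(k::int) x. if ennreal (2 powr (real_of_int k - 1)) < h x
      then ennreal (2 powr ((k + 1) * p) * 2 powr (1 - k)) * h x else 0"
  have lev: "{x. ennreal (2 powr k) < max_op \<mu> h x} \<in> sets \<mu>" for k
    by (simp add: open_in_sets open_max_op_greater)
  have "(\<integral>\<^sup>+x. epowr (max_op \<mu> h x) p \<partial>\<mu>) \<le> (\<integral>\<^sup>+x. (\<integral>\<^sup>+k. (if ennreal (2 powr real_of_int k) < max_op \<mu> h x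
      then ennreal (2 powr ((k + 1) * p)) else 0) \<partial>count_space (UNIV :: int set)) \<partial>\<mu>)"
    using p by (intro nn_integral_mono epowr_le_dyadic_sum) auto
  also have "\<dots> = (\<integral>\<^sup>+k. (\<integral>\<^sup>+x. (if ennreal (2 powr real_of_int k) < max_op \<mu> h x
      then ennreal (2 powr ((k + 1) * p)) else 0) \<partial>\<mu>) \<partial>count_space (UNIV :: int set))"
    by (rule nn_integral_count_space_nn_integral) auto
  also have "\<dots> = (\<integral>\<^sup>+k. ennreal (2 powr ((k + 1) * p)) * emeasure \<mu> {x. ennreal (2 powr real_of_int k) < max_op \<mu> h x}
      \<partial>count_space (UNIV :: int set))"
    by (intro nn_integral_cong, subst nn_integral_cmult_indicator[symmetric, OF lev])
      (auto intro!: nn_integral_cong split: split_indicator)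
  also have "\<dots> \<le> (\<integral>\<^sup>+k. ennreal D * (\<integral>\<^sup>+x. ?W k x \<partial>\<mu>) \<partial>count_space (UNIV :: int set))"
  proof (rule nn_integral_mono)
    fix k :: int
    let ?h' = "\<lambda>x. if ennreal (2 powr (k - 1)) < h x then h x else 0"
    have "ennreal (2 powr ((k + 1) * p)) * emeasure \<mu> {x. ennreal (2 powr real_of_int k) < max_op \<mu> h x}
      \<le> ennreal (2 powr ((k + 1) * p)) * (ennreal (D * 2 powr (1 - k)) * (\<integral>\<^sup>+x. ?h' x \<partial>\<mu>))"
      by (intro mult_left_mono max_op_level) auto
    also have "\<dots> = ennreal D * (ennreal (2 powr ((k + 1) * p) * 2 powr (1 - k)) * (\<integral>\<^sup>+x. ?h' x \<partial>\<mu>))"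
      using D_nonneg by (simp add: ennreal_mult mult_ac)
    also have "ennreal (2 powr ((k + 1) * p) * 2 powr (1 - k)) * (\<integral>\<^sup>+x. ?h' x \<partial>\<mu>) = (\<integral>\<^sup>+x. ?W k x \<partial>\<mu>)"
      by (subst nn_integral_cmult[symmetric]) (auto intro!: nn_integral_cong)
    finally show "ennreal (2 powr ((k + 1) * p)) * emeasure \<mu> {x. ennreal (2 powr real_of_int k) < max_op \<mu> h x}
      \<le> ennreal D * (\<integral>\<^sup>+x. ?W k x \<partial>\<mu>)" .
  qed
  also have "\<dots> = ennreal D * (\<integral>\<^sup>+k. (\<integral>\<^sup>+x. ?W k x \<partial>\<mu>) \<partial>count_space (UNIV :: int set))"
    by (rule nn_integral_cmult) simp
  also have "\<dots> = ennreal D * (\<integral>\<^sup>+x. (\<integral>\<^sup>+k. ?W k x \<partial>count_space (UNIV :: int set)) \<partial>\<mu>)"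
    by (subst nn_integral_count_space_nn_integral) auto
  also have "\<dots> \<le> ennreal D * (\<integral>\<^sup>+x. ennreal (4 powr p / (1 - 2 powr (1 - p))) * epowr (h x) p \<partial>\<mu>)"
    using p by (intro mult_left_mono nn_integral_mono dyadic_sum_le_epowr) auto
  also have "\<dots> = ennreal (max_const D p) * (\<integral>\<^sup>+x. epowr (h x) p \<partial>\<mu>)"
    using D_nonneg powr_less_mono[of "1 - p" 0 2] p
    by (simp add: nn_integral_cmult max_const_def ennreal_mult' mult.assoc del: times_divide_eq_right)
  finally show ?thesis .
qed

section \<open>Sublevel sets of \<open>A\<^sub>\<infinity>\<close> weights\<close>

lemma e2ennreal_eln_le: "e2ennreal (eln x) \<le> x"
proof (cases x)
  case (real t)
  have "ln t \<le> t" if "0 < t" using ln_bound[OF that] .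
  then show ?thesis using real by (auto simp: eln_def ennreal_le_iff2 e2ennreal_ereal e2ennreal_neg intro!: ennreal_leI)
qed (simp add: eln_def)

lemma eln_measurable [measurable]:
  assumes [measurable]: "f \<in> borel_measurable M"
  shows "(\<lambda>x. eln (f x)) \<in> borel_measurable M"
  unfolding eln_def by measurable

lemma cubes_measure:
  fixes Q :: "(real ^ 'n) set"
  assumes "Q \<in> cubes"
  shows "compact Q" "Q \<in> sets lebesgue" "0 < measure lebesgue Q"
    "emeasure lebesgue Q = ennreal (measure lebesgue Q)"
proof -
  obtain a l where Q: "Q = cbox a (\<chi> i. a $ i + l)" "0 < l"
    using assms unfolding cubes_def by auto
  then show "compact Q" "Q \<in> sets lebesgue" by (auto intro: lmeasurable_cbox fmeasurableD)
  have "measure lborel Q = l ^ CARD('n)"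
    using Q by (simp add: content_cbox_cart interval_ne_empty_cart(1) less_imp_le)
  then show "0 < measure lebesgue Q" using Q by simp
  show "emeasure lebesgue Q = ennreal (measure lebesgue Q)"
    using Q(1) by (intro emeasure_eq_ennreal_measure) (auto simp: emeasure_lborel_cbox_eq)
qed

text \<open>
  With \<open>s = exp (ln_avg Q w)\<close> the positive and negative parts of \<open>ln (w / s)\<close> have the same integral
  over \<open>Q\<close>, and the positive part is at most \<open>w / s\<close>, whose average is at most \<open>A\<close>; Chebyshev's
  inequality for the negative part gives the claim.  The \<open>pointwise\<close> fact in the proof keeps both
  parts on separate sides, so that no subtraction occurs in \<^typ>\<open>ennreal\<close>.
\<close>

lemma A_inf_cube_sublevel:
  fixes w :: "real ^ 'n \<Rightarrow> ennreal"
  assumes w: "weight w" and const: "A_inf_const w \<le> ennreal A" and Q: "Q \<in> cubes"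
    and A: "0 < A" and \<delta>: "0 < \<delta>" "\<delta> * A < 1"
  shows "emeasure lebesgue {x \<in> Q. w x < ennreal \<delta> * avg Q w}
    \<le> ennreal (A / ln (1 / (\<delta> * A))) * emeasure lebesgue Q"
proof (cases "avg Q w = 0")
  case False
  note Qm = cubes_measure[OF Q]
  define M where "M = measure lebesgue Q"
  have M: "0 < M" "emeasure lebesgue Q = ennreal M" using Qm unfolding M_def by auto
  have [measurable]: "Q \<in> sets lebesgue" by (rule Qm)
  have [measurable]: "w \<in> borel_measurable lebesgue" using w unfolding weight_def by simp
  define W where "W = (\<integral>\<^sup>+x\<in>Q. w x \<partial>lebesgue)"
  have "W < top" using w Qm unfolding weight_def W_def by auto
  then obtain Wr where Wr: "W = ennreal Wr" "0 \<le> Wr" by (cases W) auto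
  define m where "m = Wr / M"
  have avg: "avg Q w = ennreal m"
    unfolding avg_def m_def W_def[symmetric] using Wr M by (simp add: divide_ennreal)
  have m: "0 < m" using False avg Wr M unfolding m_def by (auto simp: less_le)
  define I1 where "I1 = (\<integral>\<^sup>+x\<in>Q. e2ennreal (eln (w x)) \<partial>lebesgue)"
  define I2 where "I2 = (\<integral>\<^sup>+x\<in>Q. e2ennreal (- eln (w x)) \<partial>lebesgue)"
  have "I1 \<le> W" unfolding I1_def W_def
    by (intro nn_integral_mono mult_right_mono e2ennreal_eln_le) auto
  then obtain i1 where i1: "I1 = ennreal i1" "0 \<le> i1" using Wr by (cases I1) (auto simp: top_unique)
  have L: "avg Q w * eexp (- ln_avg Q w) \<le> ennreal A"
    using const Q unfolding A_inf_const_def by (meson SUP_upper order_trans)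
  have lnavg: "ln_avg Q w = (enn2ereal I1 - enn2ereal I2) / ereal M"
    unfolding ln_avg_def I1_def I2_def M_def ..
  have "I2 \<noteq> top"
  proof
    assume "I2 = top"
    then have "ln_avg Q w = - \<infinity>" unfolding lnavg using i1 M by simp
    then show False using L m avg by (simp add: eexp_def ennreal_mult_top top_unique)
  qed
  then obtain i2 where i2: "I2 = ennreal i2" "0 \<le> i2" by (cases I2) auto
  define s where "s = exp ((i1 - i2) / M)"
  have s: "0 < s" "ln s * M = i1 - i2" using M unfolding s_def by auto
  have "ln_avg Q w = ereal ((i1 - i2) / M)" unfolding lnavg using i1 i2 M by simp
  then have "eexp (- ln_avg Q w) = ennreal (1 / s)" by (simp add: eexp_def s_def exp_minus field_simps)
  then have "ennreal (m / s) \<le> ennreal A" using L avg m s by (simp flip: ennreal_mult')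
  then have ms: "m / s \<le> A" using A by simp
  then have mAs: "m \<le> A * s" using s by (simp add: field_simps)
  \<comment> \<open>On the sublevel set \<open>w < \<delta> * m \<le> \<delta> * A * s\<close>,
    hence \<open>ln (w / s) < - T\<close> there.\<close>
  define T where "T = ln (1 / (\<delta> * A))"
  have T: "0 < T" unfolding T_def using \<delta> A by simp
  define B where "B = {x \<in> Q. w x < ennreal \<delta> * avg Q w}"
  have [measurable]: "B \<in> sets lebesgue" unfolding B_def by measurable
  have pointwise: "ennreal T * indicator B x + e2ennreal (eln (w x)) * indicator Q x + ennreal (- ln s) * indicator Q x
    \<le> ennreal (1 / s) * (w x * indicator Q x) + e2ennreal (- eln (w x)) * indicator Q x + ennreal (ln s) * indicator Q x" for x
  proof (cases "x \<in> Q")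
    case True
    consider "w x = 0" | "w x = top" | t where "w x = ennreal t" "0 < t"
      by (cases "w x") (force simp: less_le)+
    then show ?thesis
    proof cases
      case 1 then show ?thesis using True by (simp add: eln_def)
    next
      case 2 then show ?thesis using True s by (simp add: eln_def ennreal_mult_top)
    next
      case 3
      have key: "T * indicator B x + ln t - ln s \<le> t / s"
      proof (cases "x \<in> B")
        case True
        then have "t < \<delta> * m" using 3 avg m \<delta> unfolding B_def
          by (simp add: ennreal_less_iff flip: ennreal_mult)
        also have "\<dots> \<le> \<delta> * (A * s)" using mAs \<delta> by simp
        finally have "ln t < ln (\<delta> * A * s)" using 3 A \<delta> s by (simp add: mult.assoc)
        also have "\<dots> = ln s - T" unfolding T_def using A \<delta> s by (simp add: ln_mult ln_div)
        finally have "T * indicator B x + ln t - ln s < 0" using True by simp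
        moreover have "0 \<le> t / s" using 3 s by simp
        ultimately show ?thesis by linarith
      next
        case False
        have "ln t - ln s = ln (t / s)" using 3 s by (simp add: ln_div)
        also have "\<dots> \<le> t / s" using 3 s ln_bound[of "t / s"] by simp
        finally show ?thesis using False by simp
      qed
      have "ennreal T * indicator B x + ennreal (ln t) + ennreal (- ln s)
        = ennreal (T * indicator B x + max 0 (ln t) + max 0 (- ln s))"
        using T by (auto simp: ennreal_plus[symmetric] max_def ennreal_neg simp del: ennreal_plus split: split_indicator)
      also have "\<dots> \<le> ennreal (t / s + max 0 (- ln t) + max 0 (ln s))"
        using key by (intro ennreal_leI) (auto simp: max_def)
      also have "\<dots> = ennreal (1 / s) * ennreal t + ennreal (- ln t) + ennreal (ln s)"
        using 3 s by (simp add: ennreal_max_0 flip: ennreal_mult)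
      finally show ?thesis using True 3 by (simp add: eln_def)
    qed
  qed (simp add: B_def)
  have "ennreal T * emeasure lebesgue B + ennreal i1 + ennreal (- ln s) * ennreal M
    = (\<integral>\<^sup>+x. ennreal T * indicator B x + e2ennreal (eln (w x)) * indicator Q x + ennreal (- ln s) * indicator Q x \<partial>lebesgue)"
    using i1 M unfolding I1_def by (simp add: nn_integral_add nn_integral_cmult_indicator)
  also have "\<dots> \<le> (\<integral>\<^sup>+x. ennreal (1 / s) * (w x * indicator Q x) + e2ennreal (- eln (w x)) * indicator Q x + ennreal (ln s) * indicator Q x \<partial>lebesgue)"
    by (intro nn_integral_mono pointwise)
  also have "\<dots> = ennreal (1 / s) * ennreal Wr + ennreal i2 + ennreal (ln s) * ennreal M"
    using i2 Wr M unfolding I2_def W_def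
    by (simp add: nn_integral_add nn_integral_cmult nn_integral_cmult_indicator)
  finally have main: "ennreal T * emeasure lebesgue B + ennreal i1 + ennreal (- ln s) * ennreal M
    \<le> ennreal (1 / s) * ennreal Wr + ennreal i2 + ennreal (ln s) * ennreal M" .
  have "emeasure lebesgue B \<le> ennreal M" unfolding M(2)[symmetric] B_def by (intro emeasure_mono) auto
  then obtain b where b: "emeasure lebesgue B = ennreal b" "0 \<le> b"
    by (cases "emeasure lebesgue B") (auto simp: top_unique)
  have mx: "ennreal (max 0 y * M) = ennreal y * ennreal M" for y
    using M by (subst ennreal_mult) (auto simp: ennreal_max_0)
  have "ennreal (T * b + i1 + max 0 (- ln s) * M) = ennreal (T * b) + ennreal i1 + ennreal (max 0 (- ln s) * M)"
    using b T i1 M by (subst ennreal_plus, simp, simp)+ simp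
  moreover have "ennreal (T * b) = ennreal T * ennreal b"
    using b T by (intro ennreal_mult) auto
  moreover have "ennreal (1 / s * Wr + i2 + max 0 (ln s) * M) = ennreal (1 / s * Wr) + ennreal i2 + ennreal (max 0 (ln s) * M)"
    using s Wr i2 M by (subst ennreal_plus, simp, simp)+ simp
  moreover have "ennreal (1 / s * Wr) = ennreal (1 / s) * ennreal Wr"
    using s Wr by (intro ennreal_mult) auto
  ultimately have "ennreal (T * b + i1 + max 0 (- ln s) * M) \<le> ennreal (1 / s * Wr + i2 + max 0 (ln s) * M)"
    using main b unfolding mx by (simp only:)
  then have "T * b + i1 + max 0 (- ln s) * M \<le> 1 / s * Wr + i2 + max 0 (ln s) * M"
    using s Wr M i2 by (subst (asm) ennreal_le_iff) auto
  \<comment> \<open>The truncated parts of \<open>ln s\<close> recombine to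
    \<open>ln s * M = i1 - i2\<close>, which cancels both logarithmic integrals.\<close>
  then have "T * b \<le> Wr / s" using s(2) by (auto simp: max_def split: if_splits)
  also have "\<dots> = m / s * M" using M unfolding m_def by simp
  also have "\<dots> \<le> A * M" using ms M by (intro mult_right_mono) auto
  finally have "b \<le> A / T * M" using T by (simp add: field_simps)
  then have "ennreal b \<le> ennreal (A / T) * ennreal M"
    using A T M by (simp add: ennreal_leI flip: ennreal_mult)
  then show ?thesis using b M unfolding B_def T_def by simp
qed simp

text \<open>
  The strict inequality makes the condition trivially true where the average vanishes.
\<close>

definition fat_on :: "real \<Rightarrow> real \<Rightarrow> (real ^ 'n) set \<Rightarrow> (real ^ 'n \<Rightarrow> ennreal) \<Rightarrow> bool" where
  "fat_on \<delta> \<theta> Q w \<longleftrightarrow>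
     emeasure lebesgue {x \<in> Q. w x < ennreal \<delta> * avg Q w} \<le> ennreal \<theta> * emeasure lebesgue Q"

section \<open>From cubes to balls, with parameters depending only on the constant\<close>

lemma ball_volume:
  fixes x :: "real ^ 'n"
  assumes "0 \<le> r"
  shows "emeasure lebesgue (ball x r) = ennreal (unit_ball_vol (real CARD('n)) * r ^ CARD('n))"
  using emeasure_ball[OF assms, of x] by simp

lemma fat_on_mono:
  assumes "fat_on \<delta> \<theta> Q w" "\<delta>' \<le> \<delta>" "\<theta> \<le> \<theta>'"
    and [measurable]: "w \<in> borel_measurable lebesgue" "Q \<in> sets lebesgue"
  shows "fat_on \<delta>' \<theta>' Q w"
proof -
  have "emeasure lebesgue {x \<in> Q. w x < ennreal \<delta>' * avg Q w}
      \<le> emeasure lebesgue {x \<in> Q. w x < ennreal \<delta> * avg Q w}"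
    using assms(2) by (intro emeasure_mono) (auto elim!: less_le_trans intro!: mult_right_mono ennreal_leI)
  also have "\<dots> \<le> ennreal \<theta>' * emeasure lebesgue Q"
    using assms unfolding fat_on_def by (meson ennreal_leI mult_right_mono order_trans zero_le)
  finally show ?thesis unfolding fat_on_def .
qed

text \<open>The ball lies in the concentric cube of side \<open>2 * r\<close>, whose volume is
  \<open>c\<close> times larger. Hence the average over the ball is at most \<open>c\<close> times
  that over the cube, and the relative size of the exceptional set grows by at most
  \<open>c\<close>.\<close>

lemma fat_on_ball_of_cubes:
  fixes w :: "real ^ 'n \<Rightarrow> ennreal" and x :: "real ^ 'n"
  defines "c \<equiv> 2 ^ CARD('n) / unit_ball_vol (real CARD('n))"
  assumes [measurable]: "w \<in> borel_measurable lebesgue"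
    and cubes: "\<And>Q. Q \<in> cubes \<Longrightarrow> fat_on (\<delta> * c) \<theta> Q w"
    and r: "0 < r" and nonneg: "0 \<le> \<delta>" "0 \<le> \<theta>"
  shows "fat_on \<delta> (c * \<theta>) (ball x r) w"
proof -
  define \<omega> where "\<omega> = unit_ball_vol (real CARD('n))"
  have \<omega>: "0 < \<omega>" unfolding \<omega>_def by simp
  have c: "0 < c" "c = 2 ^ CARD('n) / \<omega>" using \<omega> unfolding c_def \<omega>_def by auto
  define Q where "Q = cbox (\<chi> i. x $ i - r) (\<chi> i. (\<chi> i. x $ i - r) $ i + 2 * r)"
  have Q: "Q \<in> cubes" unfolding Q_def cubes_def using r by fastforce
  have [measurable]: "Q \<in> sets lebesgue" by (rule cubes_measure[OF Q])
  have sub: "ball x r \<subseteq> Q"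
  proof
    fix y assume "y \<in> ball x r"
    then have "\<bar>(y - x) $ i\<bar> < r" for i
      using component_le_norm_cart[of "y - x" i] by (simp add: dist_norm norm_minus_commute)
    then show "y \<in> Q" unfolding Q_def by (auto simp: mem_box_cart abs_less_iff) (smt (verit))+
  qed
  have Q_vol: "emeasure lebesgue Q = ennreal c * emeasure lebesgue (ball x r)"
  proof -
    have "measure lebesgue Q = (2 * r) ^ CARD('n)"
      using r unfolding Q_def by (simp add: content_cbox_cart interval_ne_empty_cart(1))
    then have "emeasure lebesgue Q = ennreal ((2 * r) ^ CARD('n))"
      unfolding cubes_measure(4)[OF Q] by (rule arg_cong)
    also have "\<dots> = ennreal (c * (\<omega> * r ^ CARD('n)))"
      using \<omega> unfolding c(2) by (simp add: power_mult_distrib)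
    finally show ?thesis
      unfolding ball_volume[OF less_imp_le[OF r]] \<omega>_def[symmetric] ennreal_mult'[OF less_imp_le[OF c(1)]] .
  qed
  have avg: "avg (ball x r) w \<le> ennreal c * avg Q w"
  proof -
    have "(\<integral>\<^sup>+y\<in>ball x r. w y \<partial>lebesgue) \<le> (\<integral>\<^sup>+y\<in>Q. w y \<partial>lebesgue)"
      using sub by (intro nn_integral_mono) (auto split: split_indicator)
    then have "avg (ball x r) w \<le> (\<integral>\<^sup>+y\<in>Q. w y \<partial>lebesgue) / emeasure lebesgue (ball x r)"
      unfolding avg_def by (rule divide_right_mono_ennreal)
    also have "\<dots> = ennreal c * avg Q w"
    proof -
      have "ennreal c * (X / (ennreal c * V)) = X / V" for X V :: ennreal
      proof -
        have "ennreal c * (X / (ennreal c * V)) = X * ennreal c / (V * ennreal c)"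
          by (simp only: ennreal_times_divide mult.commute)
        also have "\<dots> = X / V" using c by (intro divide_mult_eq) auto
        finally show ?thesis .
      qed
      then show ?thesis unfolding avg_def Q_vol by (rule sym)
    qed
    finally show ?thesis .
  qed
  have "emeasure lebesgue {y \<in> ball x r. w y < ennreal \<delta> * avg (ball x r) w}
    \<le> emeasure lebesgue {y \<in> Q. w y < ennreal (\<delta> * c) * avg Q w}"
  proof (rule emeasure_mono)
    have "ennreal \<delta> * avg (ball x r) w \<le> ennreal \<delta> * (ennreal c * avg Q w)"
      using avg by (rule mult_left_mono) simp
    also have "\<dots> = ennreal (\<delta> * c) * avg Q w" using nonneg c(1) by (simp add: ennreal_mult mult.assoc)
    finally show "{y \<in> ball x r. w y < ennreal \<delta> * avg (ball x r) w} \<subseteq> {y \<in> Q. w y < ennreal (\<delta> * c) * avg Q w}"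
      using sub by (auto intro: less_le_trans)
  qed measurable
  also have "\<dots> \<le> ennreal \<theta> * emeasure lebesgue Q"
    using cubes[OF Q] unfolding fat_on_def .
  also have "\<dots> = ennreal (c * \<theta>) * emeasure lebesgue (ball x r)"
    unfolding Q_vol using c(1) nonneg by (simp add: ennreal_mult mult_ac)
  finally show ?thesis unfolding fat_on_def .
qed

text \<open>The bound \<open>A / ln (1 / (\<delta> * A))\<close> of
  \<open>A_inf_cube_sublevel\<close> tends to 0 with \<delta>, so any prescribed portion can be
  reached. Here \<delta> is fixed from \<theta> and \<open>a\<close> before any weight is given;
  this is why the final constant sees the weights only through their A_\<infinity>
  constants.\<close>

lemma A_inf_fat:
  assumes \<theta>: "0 < \<theta>"
  obtains \<delta> where "0 < \<delta>" "\<delta> < 1"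
    "\<And>w Q. w \<in> A_inf \<Longrightarrow> A_inf_const w = (a :: ennreal) \<Longrightarrow> Q \<in> cubes \<Longrightarrow> fat_on \<delta> \<theta> Q (w :: real ^ 'n \<Rightarrow> ennreal)"
    "\<And>w x r. w \<in> A_inf \<Longrightarrow> A_inf_const w = a \<Longrightarrow> 0 < r \<Longrightarrow> fat_on \<delta> \<theta> (ball x r) (w :: real ^ 'n \<Rightarrow> ennreal)"
proof -
  define c where "c = 2 ^ CARD('n) / unit_ball_vol (real CARD('n))"
  \<comment> \<open>Adding 1 keeps \<open>A\<close> positive for every \<open>a\<close>, including
    \<open>top\<close>, which \<open>enn2real\<close> sends to 0 and for which no weight
    qualifies.\<close>
  define A where "A = enn2real a + 1"
  \<comment> \<open>\<open>T\<close> makes the exceptional portion \<open>A / T\<close> on cubes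
    equal to \<open>\<theta> / max 1 c\<close>. The factor \<open>max 1 c\<close>, here and in
    \<delta>, pays for the passage to balls without harming cubes.\<close>
  define T where "T = A * max 1 c / \<theta>"
  define \<delta> where "\<delta> = min (1 / 2) (exp (- T) / (A * max 1 c))"
  have c: "0 < c" unfolding c_def by simp
  have A: "0 < A" unfolding A_def by (simp add: add_nonneg_pos)
  have T: "0 < T" unfolding T_def using A \<theta> by simp
  have \<delta>: "0 < \<delta>" "\<delta> < 1" unfolding \<delta>_def using A by auto
  have cube: "fat_on (\<delta> * max 1 c) (\<theta> / max 1 c) Q w"
    if "w \<in> A_inf" "A_inf_const w = a" "Q \<in> cubes" for w :: "real ^ 'n \<Rightarrow> ennreal" and Q
  proof -
    have w: "weight w" "a < top" using that unfolding A_inf_def by auto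
    have meas [measurable]: "w \<in> borel_measurable lebesgue" using w unfolding weight_def by simp
    have "a \<le> ennreal A" using w(2) unfolding A_def by (cases a) auto
    then have "emeasure lebesgue {x \<in> Q. w x < ennreal (exp (- T) / A) * avg Q w}
      \<le> ennreal (A / ln (1 / (exp (- T) / A * A))) * emeasure lebesgue Q"
      using w that A T by (intro A_inf_cube_sublevel) auto
    also have "A / ln (1 / (exp (- T) / A * A)) = \<theta> / max 1 c"
    proof -
      have "1 / (exp (- T) / A * A) = exp T" using A by (simp add: exp_minus field_simps)
      then have "A / ln (1 / (exp (- T) / A * A)) = A / T" by (simp only: ln_exp)
      then show ?thesis unfolding T_def using A by simp
    qed
    finally have "fat_on (exp (- T) / A) (\<theta> / max 1 c) Q w" unfolding fat_on_def .
    moreover have "\<delta> * max 1 c \<le> exp (- T) / A"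
    proof -
      have "\<delta> * max 1 c \<le> exp (- T) / (A * max 1 c) * max 1 c"
        unfolding \<delta>_def by (intro mult_right_mono) auto
      then show ?thesis by simp
    qed
    ultimately show ?thesis using cubes_measure(2)[OF that(3)] meas by (auto intro: fat_on_mono)
  qed
  show ?thesis
  proof (rule that[OF \<delta>])
    fix w :: "real ^ 'n \<Rightarrow> ennreal" and Q :: "(real ^ 'n) set" assume *: "w \<in> A_inf" "A_inf_const w = a" "Q \<in> cubes"
    have "\<delta> \<le> \<delta> * max 1 c" "\<theta> / max 1 c \<le> \<theta>" using \<delta> \<theta> by (auto simp: divide_le_eq mult_le_cancel_left1)
    then show "fat_on \<delta> \<theta> Q w" using cube[OF *] * cubes_measure(2)[of Q]
      by (auto intro!: fat_on_mono[OF cube[OF *]] simp: A_inf_def weight_def)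
  next
    fix w :: "real ^ 'n \<Rightarrow> ennreal" and x :: "real ^ 'n" and r :: real
    assume *: "w \<in> A_inf" "A_inf_const w = a" "0 < r"
    have [measurable]: "w \<in> borel_measurable lebesgue" using * by (auto simp: A_inf_def weight_def)
    have 1: "fat_on (\<delta> * c) (\<theta> / max 1 c) Q w" if "Q \<in> cubes" for Q :: "(real ^ 'n) set"
      using \<delta> cubes_measure(2)[OF that]
      by (intro fat_on_mono[OF cube[OF *(1,2) that]]) (auto intro: mult_left_mono)
    have "fat_on \<delta> (c * (\<theta> / max 1 c)) (ball x r) w"
      unfolding c_def
      by (rule fat_on_ball_of_cubes) (use 1 * \<delta> \<theta> in \<open>auto simp: c_def\<close>)
    moreover have "c * (\<theta> / max 1 c) \<le> \<theta>" using c \<theta> by (simp add: field_simps)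
    ultimately show "fat_on \<delta> \<theta> (ball x r) w" by (auto intro: fat_on_mono)
  qed
qed

section \<open>Pairs of weights\<close>

lemma ball_in_sets_lebesgue [measurable, simp]: "ball (x :: 'a::euclidean_space) r \<in> sets lebesgue"
  using lmeasurable_ball by (rule fmeasurableD)

text \<open>\<open>E\<close> fills at least the portion \<open>2 * \<theta>\<close> of
  \<open>Q\<close> and the exceptional set at most \<theta>, so a portion \<theta> of points at
  which \<open>w\<close> reaches the threshold remains in \<open>E\<close>.\<close>

lemma fat_on_subset:
  assumes fat: "fat_on \<delta> \<theta> Q w" and sub: "E \<subseteq> Q" and large: "ennreal (2 * \<theta>) * emeasure lebesgue Q \<le> emeasure lebesgue E"
    and [measurable]: "w \<in> borel_measurable lebesgue" "Q \<in> sets lebesgue" "E \<in> sets lebesgue"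
    and Q: "0 < emeasure lebesgue Q" "emeasure lebesgue Q < top" and pos: "0 < \<delta>" "0 < \<theta>"
  shows "ennreal (\<delta> * \<theta>) * (\<integral>\<^sup>+x\<in>Q. w x \<partial>lebesgue) \<le> (\<integral>\<^sup>+x\<in>E. w x \<partial>lebesgue)"
proof -
  define B where "B = {x \<in> Q. w x < ennreal \<delta> * avg Q w}"
  have [measurable]: "B \<in> sets lebesgue" unfolding B_def by measurable
  have "ennreal \<theta> * emeasure lebesgue Q + ennreal \<theta> * emeasure lebesgue Q \<le> emeasure lebesgue E"
    using large pos by (simp add: ennreal_plus[symmetric] flip: distrib_right del: ennreal_plus)
  also have "\<dots> \<le> emeasure lebesgue ((E - B) \<union> B)" by (intro emeasure_mono) auto
  also have "\<dots> \<le> emeasure lebesgue (E - B) + emeasure lebesgue B"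
    by (intro emeasure_subadditive) auto
  also have "\<dots> \<le> emeasure lebesgue (E - B) + ennreal \<theta> * emeasure lebesgue Q"
    using fat unfolding fat_on_def B_def by (rule add_left_mono)
  finally have *: "ennreal \<theta> * emeasure lebesgue Q \<le> emeasure lebesgue (E - B)"
    using Q by (auto simp: ennreal_mult_eq_top_iff)
  have "ennreal (\<delta> * \<theta>) * (\<integral>\<^sup>+x\<in>Q. w x \<partial>lebesgue) = ennreal \<delta> * avg Q w * (ennreal \<theta> * emeasure lebesgue Q)"
  proof -
    have "(\<integral>\<^sup>+x\<in>Q. w x \<partial>lebesgue) = avg Q w * emeasure lebesgue Q"
      unfolding avg_def using Q by (simp add: ennreal_divide_times)
    then show ?thesis using pos by (simp add: ennreal_mult mult_ac)
  qed
  also have "\<dots> \<le> ennreal \<delta> * avg Q w * emeasure lebesgue (E - B)"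
    using * by (rule mult_left_mono) simp
  also have "\<dots> = (\<integral>\<^sup>+x. ennreal \<delta> * avg Q w * indicator (E - B) x \<partial>lebesgue)"
    by (rule nn_integral_cmult_indicator[symmetric]) simp
  also have "\<dots> \<le> (\<integral>\<^sup>+x\<in>E. w x \<partial>lebesgue)"
    using sub by (intro nn_integral_mono) (auto simp: B_def not_less split: split_indicator)
  finally show ?thesis .
qed

text \<open>The two exceptional sets together fill at most \<open>2 * \<theta>\<close>, that is, at
  most half of \<open>Q\<close>.\<close>

lemma fat_on_pair:
  assumes fat: "fat_on \<delta> \<theta> Q u" "fat_on \<delta> \<theta> Q s" and \<theta>: "0 \<le> \<theta>" "4 * \<theta> \<le> 1"
    and [measurable]: "u \<in> borel_measurable lebesgue" "s \<in> borel_measurable lebesgue" "Q \<in> sets lebesgue"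
    and Q: "emeasure lebesgue Q < top"
  shows "emeasure lebesgue Q
    \<le> 2 * emeasure lebesgue {x \<in> Q. ennreal \<delta> * avg Q u \<le> u x \<and> ennreal \<delta> * avg Q s \<le> s x}"
    (is "_ \<le> 2 * emeasure lebesgue ?E")
proof -
  let ?A = "\<lambda>w. {x \<in> Q. w x < ennreal \<delta> * avg Q w}"
  have "emeasure lebesgue Q \<le> emeasure lebesgue (?E \<union> (?A u \<union> ?A s))"
    by (intro emeasure_mono) auto
  also have "\<dots> \<le> emeasure lebesgue ?E + emeasure lebesgue (?A u \<union> ?A s)"
    by (intro emeasure_subadditive) auto
  also have "\<dots> \<le> emeasure lebesgue ?E + (emeasure lebesgue (?A u) + emeasure lebesgue (?A s))"
    by (intro add_left_mono emeasure_subadditive) auto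
  also have "\<dots> \<le> emeasure lebesgue ?E + (ennreal \<theta> * emeasure lebesgue Q + ennreal \<theta> * emeasure lebesgue Q)"
    using fat unfolding fat_on_def by (intro add_mono order_refl)
  also have "ennreal \<theta> * emeasure lebesgue Q + ennreal \<theta> * emeasure lebesgue Q = ennreal (2 * \<theta>) * emeasure lebesgue Q"
    using \<theta> by (simp add: ennreal_plus[symmetric] flip: distrib_right del: ennreal_plus)
  also have "\<dots> \<le> ennreal (1 / 2) * emeasure lebesgue Q"
    using \<theta> by (intro mult_right_mono ennreal_leI) auto
  finally have *: "emeasure lebesgue Q \<le> emeasure lebesgue ?E + ennreal (1 / 2) * emeasure lebesgue Q"
    by (simp add: add_left_mono)
  have "emeasure lebesgue ?E \<le> emeasure lebesgue Q" by (intro emeasure_mono) auto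
  then obtain e m where em: "emeasure lebesgue ?E = ennreal e" "emeasure lebesgue Q = ennreal m" "0 \<le> e" "0 \<le> m"
    using Q by (cases "emeasure lebesgue ?E"; cases "emeasure lebesgue Q") (auto simp: top_unique)
  have "ennreal m \<le> ennreal (e + 1 / 2 * m)"
  proof -
    have "ennreal (1 / 2) * ennreal m = ennreal (1 / 2 * m)" using em by (intro ennreal_mult[symmetric]) auto
    then show ?thesis using * em by (simp add: ennreal_plus del: ennreal_half)
  qed
  then have "m \<le> 2 * e" using em by (subst (asm) ennreal_le_iff) auto
  then have "ennreal m \<le> ennreal (2 * e)" by (rule ennreal_leI)
  then show ?thesis using em by (simp add: ennreal_mult)
qed

text \<open>The points at which both weights reach their thresholds have positive measure, so one of
  them also satisfies the almost everywhere bound. Evaluating there replaces values by averages, and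
  homogeneity produces the power of \<delta>.\<close>

lemma fat_on_two_weight_bound:
  assumes fat: "fat_on \<delta> \<theta> Q u" "fat_on \<delta> \<theta> Q s" and \<theta>: "0 \<le> \<theta>" "4 * \<theta> \<le> 1"
    and [measurable]: "u \<in> borel_measurable lebesgue" "s \<in> borel_measurable lebesgue" "Q \<in> sets lebesgue"
    and Q: "0 < emeasure lebesgue Q" "emeasure lebesgue Q < top"
    and pos: "0 < \<delta>" "0 < a" "0 < b"
    and bound: "AE x in lebesgue. epowr (u x) a * epowr (s x) b \<le> ennreal C"
  shows "epowr (avg Q u) a * epowr (avg Q s) b \<le> ennreal (C * \<delta> powr - (a + b))"
proof -
  define E where "E = {x \<in> Q. ennreal \<delta> * avg Q u \<le> u x \<and> ennreal \<delta> * avg Q s \<le> s x}"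
  have [measurable]: "E \<in> sets lebesgue" unfolding E_def by measurable
  have "emeasure lebesgue E \<noteq> 0"
    using fat_on_pair[OF fat \<theta>] Q unfolding E_def by auto
  have "\<exists>x\<in>E. epowr (u x) a * epowr (s x) b \<le> ennreal C"
  proof (rule ccontr)
    assume none: "\<not> ?thesis"
    have "AE x in lebesgue. x \<notin> E" using bound by eventually_elim (use none in auto)
    then have "E \<in> null_sets lebesgue" by (subst AE_iff_null_sets) simp_all
    then have "emeasure lebesgue E = 0" by (rule null_setsD1)
    with \<open>emeasure lebesgue E \<noteq> 0\<close> show False ..
  qed
  then obtain x where x: "ennreal \<delta> * avg Q u \<le> u x" "ennreal \<delta> * avg Q s \<le> s x"
    "epowr (u x) a * epowr (s x) b \<le> ennreal C" unfolding E_def by auto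
  have "ennreal (\<delta> powr (a + b)) * (epowr (avg Q u) a * epowr (avg Q s) b)
    = epowr (ennreal \<delta> * avg Q u) a * epowr (ennreal \<delta> * avg Q s) b"
    using pos by (simp add: epowr_mult epowr_ennreal powr_add ennreal_mult mult_ac)
  also have "\<dots> \<le> epowr (u x) a * epowr (s x) b"
    using x pos by (intro mult_mono epowr_mono) auto
  also have "\<dots> \<le> ennreal C" by (rule x)
  finally have *: "ennreal (\<delta> powr (a + b)) * (epowr (avg Q u) a * epowr (avg Q s) b) \<le> ennreal C" .
  have "epowr (avg Q u) a * epowr (avg Q s) b
    = ennreal (\<delta> powr - (a + b)) * (ennreal (\<delta> powr (a + b)) * (epowr (avg Q u) a * epowr (avg Q s) b))"
    using pos by (simp flip: mult.assoc ennreal_mult powr_add)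
  also have "\<dots> \<le> ennreal (\<delta> powr - (a + b)) * ennreal C"
    using * by (rule mult_left_mono) simp
  also have "\<dots> = ennreal (C * \<delta> powr - (a + b))"
    by (simp add: ennreal_mult'' mult.commute)
  finally show ?thesis .
qed

text \<open>A ball fills the portion 3^(-n) of its threefold dilation, and the shell between radii
  \<open>r\<close> and \<open>2 * r\<close> fills at least that portion of the larger ball. The
  exceptional portion is half of this, as \<open>fat_on_subset\<close> requires.\<close>

locale weight_fat_on_balls =
  fixes w :: "real ^ 'n \<Rightarrow> ennreal" and \<delta> :: real
  assumes meas [measurable]: "w \<in> borel_measurable lebesgue"
    and \<delta>: "0 < \<delta>" "\<delta> < 1"
    and fat: "0 < r \<Longrightarrow> fat_on \<delta> (1 / (2 * 3 ^ CARD('n))) (ball x r) w"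
    and integral_ball_finite: "(\<integral>\<^sup>+y\<in>ball x r. w y \<partial>lebesgue) < top"
begin

lemma emeasure_ball_density:
  "emeasure (density lebesgue w) (ball x r) = (\<integral>\<^sup>+y\<in>ball x r. w y \<partial>lebesgue)"
  by (simp add: emeasure_density)

lemma integral_subset_ball:
  assumes "0 < r" "E \<in> sets lebesgue" "E \<subseteq> ball x r"
    and "ennreal (1 / 3 ^ CARD('n)) * emeasure lebesgue (ball x r) \<le> emeasure lebesgue E"
  shows "ennreal (\<delta> / (2 * 3 ^ CARD('n))) * (\<integral>\<^sup>+y\<in>ball x r. w y \<partial>lebesgue) \<le> (\<integral>\<^sup>+y\<in>E. w y \<partial>lebesgue)"
  using fat_on_subset[OF fat[OF assms(1)] assms(3)] assms \<delta> ball_volume[of r x]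
  by simp

lemma integral_ball_triple:
  assumes r: "0 < r"
  shows "(\<integral>\<^sup>+y\<in>ball x (3 * r). w y \<partial>lebesgue) \<le> ennreal (2 * 3 ^ CARD('n) / \<delta>) * (\<integral>\<^sup>+y\<in>ball x r. w y \<partial>lebesgue)"
proof -
  have "ennreal (\<delta> / (2 * 3 ^ CARD('n))) * (\<integral>\<^sup>+y\<in>ball x (3 * r). w y \<partial>lebesgue) \<le> (\<integral>\<^sup>+y\<in>ball x r. w y \<partial>lebesgue)"
  proof (rule integral_subset_ball)
    show "ennreal (1 / 3 ^ CARD('n)) * emeasure lebesgue (ball x (3 * r)) \<le> emeasure lebesgue (ball x r)"
      using r by (subst (1 2) ball_volume) (auto simp: power_mult_distrib simp flip: ennreal_mult)
  qed (use r in auto)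
  then have "ennreal (2 * 3 ^ CARD('n) / \<delta>) * (ennreal (\<delta> / (2 * 3 ^ CARD('n))) * (\<integral>\<^sup>+y\<in>ball x (3 * r). w y \<partial>lebesgue))
    \<le> ennreal (2 * 3 ^ CARD('n) / \<delta>) * (\<integral>\<^sup>+y\<in>ball x r. w y \<partial>lebesgue)"
    by (rule mult_left_mono) simp
  moreover have "ennreal (2 * 3 ^ CARD('n) / \<delta>) * ennreal (\<delta> / (2 * 3 ^ CARD('n))) = 1"
    using \<delta> by (simp flip: ennreal_mult)
  ultimately show ?thesis by (simp flip: mult.assoc)
qed

lemma AE_finite: "AE x in lebesgue. w x \<noteq> top"
proof -
  have "AE x in lebesgue. \<forall>k::nat. w x * indicator (ball 0 (real k)) x \<noteq> \<infinity>"
    unfolding AE_all_countable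
    by (intro allI nn_integral_PInf_AE) (use integral_ball_finite in \<open>auto simp: less_top\<close>)
  then show ?thesis
  proof eventually_elim
    case (elim x)
    obtain k :: nat where "norm x < real k" using reals_Archimedean2 by blast
    then show ?case using elim[rule_format, of k] by (auto split: split_indicator)
  qed
qed

text \<open>Tripling propagates a vanishing integral to concentric balls that exhaust the space. A
  weight is therefore either trivial or has positive mass on every ball, the dichotomy behind
  \<open>fat_weight\<close>.\<close>

lemma AE_zero:
  assumes r: "0 < r" and zero: "(\<integral>\<^sup>+y\<in>ball c r. w y \<partial>lebesgue) = 0"
  shows "AE x in lebesgue. w x = 0"
proof -
  have "(\<integral>\<^sup>+y\<in>ball c (3 ^ k * r). w y \<partial>lebesgue) = 0" for k :: nat
  proof (induction k)
    case (Suc k)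
    have "(\<integral>\<^sup>+y\<in>ball c (3 * (3 ^ k * r)). w y \<partial>lebesgue) \<le> ennreal (2 * 3 ^ CARD('n) / \<delta>) * 0"
      unfolding Suc[symmetric] using r by (intro integral_ball_triple) simp
    then show ?case by (simp add: mult.assoc)
  qed (use zero in simp)
  then have "AE x in lebesgue. \<forall>k::nat. w x * indicator (ball c (3 ^ k * r)) x = 0"
    unfolding AE_all_countable by (subst (asm) nn_integral_0_iff_AE) auto
  then show ?thesis
  proof eventually_elim
    case (elim x)
    obtain k :: nat where "dist c x / r < 3 ^ k" using real_arch_pow[of 3] by auto
    then have "x \<in> ball c (3 ^ k * r)" using r by (simp add: field_simps)
    then show ?case using elim[rule_format, of k] by simp
  qed
qed

end

locale fat_weight = weight_fat_on_balls w \<delta>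
  for w :: "real ^ 'n \<Rightarrow> ennreal" and \<delta> :: real +
  assumes integral_ball_pos: "0 < r \<Longrightarrow> 0 < (\<integral>\<^sup>+y\<in>ball x r. w y \<partial>lebesgue)"
begin

sublocale doubling_measure "density lebesgue w" "2 * 3 ^ CARD('n) / \<delta>"
proof
  show "sets borel \<subseteq> sets (density lebesgue w)" by auto
  show "0 \<le> 2 * 3 ^ CARD('n) / \<delta>" using \<delta> by simp
next
  fix x :: "real ^ 'n" and r :: real
  show "emeasure (density lebesgue w) (ball x r) < top"
    unfolding emeasure_ball_density by (rule integral_ball_finite)
  assume r: "0 < r"
  show "0 < emeasure (density lebesgue w) (ball x r)"
    unfolding emeasure_ball_density using r by (rule integral_ball_pos)
  show "emeasure (density lebesgue w) (ball x (3 * r)) \<le> ennreal (2 * 3 ^ CARD('n) / \<delta>) * emeasure (density lebesgue w) (ball x r)"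
    unfolding emeasure_ball_density using r by (rule integral_ball_triple)
qed

lemma measure_ball_pos: "0 < r \<Longrightarrow> 0 < measure (density lebesgue w) (ball x r)"
  and emeasure_ball_eq: "emeasure (density lebesgue w) (ball x r) = ennreal (measure (density lebesgue w) (ball x r))"
proof -
  show "emeasure (density lebesgue w) (ball x r) = ennreal (measure (density lebesgue w) (ball x r))"
    using ball_finite[of x r] by (intro emeasure_eq_ennreal_measure) simp
  show "0 < measure (density lebesgue w) (ball x r)" if "0 < r"
    using ball_pos[OF that, of x] ball_finite[of x r] unfolding measure_def enn2real_positive_iff by simp
qed

lemma decay: "0 < (1 - \<delta> / (2 * 3 ^ CARD('n)))" "(1 - \<delta> / (2 * 3 ^ CARD('n))) < 1"
proof -
  have "(1 :: real) \<le> 3 ^ CARD('n)" by simp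
  then have "\<delta> < 2 * 3 ^ CARD('n)" using \<delta> by linarith
  then show "0 < (1 - \<delta> / (2 * 3 ^ CARD('n)))" "(1 - \<delta> / (2 * 3 ^ CARD('n))) < 1" using \<delta> by (auto simp: divide_less_eq)
qed

text \<open>The shell between the two balls fills at least 1 - 2^(-n) \<ge> 3^(-n) of the larger
  one, so it carries a fixed share of the mass. This reverse doubling provides the geometric series
  in \<open>hedberg\<close>.\<close>

lemma measure_ball_decay:
  assumes r: "0 < r"
  shows "measure (density lebesgue w) (ball x r) \<le> (1 - \<delta> / (2 * 3 ^ CARD('n))) * measure (density lebesgue w) (ball x (2 * r))"
proof -
  let ?W = "\<lambda>r. measure (density lebesgue w) (ball x r)"
  have "(1 / 3) ^ CARD('n) \<le> (1 / 3 :: real)" "(1 / 2) ^ CARD('n) \<le> (1 / 2 :: real)"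
    using power_decreasing[of 1 "CARD('n)" "1 / 3 :: real"] power_decreasing[of 1 "CARD('n)" "1 / 2 :: real"]
    by (auto simp: Suc_le_eq)
  then have num: "1 / 3 ^ CARD('n) \<le> 1 - 1 / (2::real) ^ CARD('n)" unfolding power_divide power_one by linarith
  define \<omega> where "\<omega> = unit_ball_vol (real CARD('n))"
  have \<omega>: "0 < \<omega>" unfolding \<omega>_def by simp
  have "ennreal (1 / 3 ^ CARD('n)) * emeasure lebesgue (ball x (2 * r))
      = ennreal (1 / 3 ^ CARD('n) * (\<omega> * (2 * r) ^ CARD('n)))"
    using r by (subst ball_volume) (auto simp: \<omega>_def simp flip: ennreal_mult)
  also have "\<dots> \<le> ennreal ((1 - 1 / 2 ^ CARD('n)) * (\<omega> * (2 * r) ^ CARD('n)))"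
    using num \<omega> r by (intro ennreal_leI mult_right_mono) auto
  also have "\<dots> = ennreal (\<omega> * (2 * r) ^ CARD('n) - \<omega> * r ^ CARD('n))"
    by (simp add: left_diff_distrib power_mult_distrib)
  also have "\<dots> = emeasure lebesgue (ball x (2 * r) - ball x r)"
  proof -
    have "emeasure lebesgue (ball x (2 * r) - ball x r) = emeasure lebesgue (ball x (2 * r)) - emeasure lebesgue (ball x r)"
      using r emeasure_lborel_ball_finite[of x r] by (intro emeasure_Diff) auto
    also have "\<dots> = ennreal (\<omega> * (2 * r) ^ CARD('n)) - ennreal (\<omega> * r ^ CARD('n))"
      unfolding \<omega>_def using r by (subst (1 2) ball_volume) auto
    also have "\<dots> = ennreal (\<omega> * (2 * r) ^ CARD('n) - \<omega> * r ^ CARD('n))"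
      using \<omega> r by (intro ennreal_minus) auto
    finally show ?thesis ..
  qed
  finally have "ennreal (\<delta> / (2 * 3 ^ CARD('n))) * (\<integral>\<^sup>+y\<in>ball x (2 * r). w y \<partial>lebesgue)
      \<le> (\<integral>\<^sup>+y\<in>ball x (2 * r) - ball x r. w y \<partial>lebesgue)"
    using r by (intro integral_subset_ball) auto
  also have "\<dots> = emeasure (density lebesgue w) (ball x (2 * r) - ball x r)"
    by (simp add: emeasure_density)
  also have "\<dots> = ennreal (?W (2 * r) - ?W r)"
    using r by (subst emeasure_Diff) (auto simp: emeasure_ball_eq ennreal_minus)
  finally have "ennreal (\<delta> / (2 * 3 ^ CARD('n)) * ?W (2 * r)) \<le> ennreal (?W (2 * r) - ?W r)"
    using \<delta> unfolding emeasure_ball_density[symmetric] emeasure_ball_eq by (subst ennreal_mult) auto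
  \<comment> \<open>Positivity on the left rules out that the difference on the right was truncated
    to 0 by \<open>ennreal\<close>.\<close>
  moreover have "0 < \<delta> / (2 * 3 ^ CARD('n)) * ?W (2 * r)"
    using \<delta> r measure_ball_pos[of "2 * r" x] by simp
  ultimately have "\<delta> / (2 * 3 ^ CARD('n)) * ?W (2 * r) \<le> ?W (2 * r) - ?W r"
    by (metis ennreal_le_iff2 not_le)
  then show ?thesis by (simp add: algebra_simps)
qed

end

text \<open>\<open>s\<close> stands for the dual weight, a negative power of \<open>v\<close>. The
  locale does not relate it to \<open>u\<close>; the pointwise relation enters later as an almost
  everywhere bound.\<close>

locale two_fat_weights =
  u: fat_weight u \<delta> + s: fat_weight s \<delta>
  for u s :: "real ^ 'n \<Rightarrow> ennreal" and \<delta> :: real +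
  fixes p p' :: real
  assumes p: "1 < p" and conj: "1 / p + 1 / p' = 1"
begin

lemma p': "1 < p'" "p' * (p - 1) = p" "1 / (p' * (p - 1)) = 1 / p"
proof -
  have "p' \<noteq> 0" using conj p by auto
  then have *: "p' + p = p * p'" using conj p by (simp add: field_simps)
  then show "p' * (p - 1) = p" by (simp add: algebra_simps)
  then show "1 / (p' * (p - 1)) = 1 / p" by simp
  have "1 / p' = 1 - 1 / p" using conj by simp
  then have "0 < 1 / p'" "1 / p' < 1" using p by auto
  then show "1 < p'" by (simp add: divide_less_eq)
qed

section \<open>An intermediate function linking the two maximal operators\<close>

abbreviation "U \<equiv> density lebesgue u"
abbreviation "S \<equiv> density lebesgue s"

text \<open>
  Every ball average of \<open>interm g\<close> with respect to \<open>U\<close> dominates the corresponding power of the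
  \<open>S\<close>-average of \<open>g\<close>, while its \<open>p'\<close>-th power times \<open>u\<close> is at most \<open>(max_op S g)\<^sup>p s\<close>.  This is how two
  one-weight maximal inequalities combine into a two-weight one.
\<close>

definition interm :: "(real ^ 'n \<Rightarrow> ennreal) \<Rightarrow> real ^ 'n \<Rightarrow> ennreal" where
  "interm g x = epowr (max_op S g x) (p - 1) * epowr (s x / u x) (1 / p')"

lemma interm_measurable [measurable]: "interm g \<in> borel_measurable lebesgue"
proof -
  have [measurable]: "max_op S g \<in> borel_measurable lebesgue"
    using s.max_op_measurable[of g] by simp
  show ?thesis unfolding interm_def by measurable
qed

text \<open>Where \<open>u\<close> is finite and positive, \<open>interm g * u\<close> equals (M_S
  g)^(p-1) s^(1/p') u^(1/p). On at least half of the ball both weights are at least \<delta> times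
  their averages, while the maximal function is at least the average of \<open>g\<close> on the
  whole ball. Integrating over that half and dividing by the \<open>U\<close>-mass gives the
  bound.\<close>

lemma interm_lower:
  assumes r: "0 < r" and x: "x \<in> ball c r" and [measurable]: "g \<in> borel_measurable lebesgue"
  shows "epowr ((\<integral>\<^sup>+y\<in>ball c r. g y \<partial>S) / emeasure S (ball c r)) (p - 1)
      * ennreal ((measure S (ball c r) / measure U (ball c r)) powr (1 / p'))
    \<le> ennreal (2 / \<delta>) * max_op U (interm g) x"
proof -
  let ?B = "ball c r"
  define m where "m = (\<integral>\<^sup>+y\<in>?B. g y \<partial>S) / emeasure S ?B"
  define a where "a = measure U ?B"
  define b where "b = measure S ?B"
  define \<beta> where "\<beta> = measure lebesgue ?B"
  have \<beta>: "0 < \<beta>" "emeasure lebesgue ?B = ennreal \<beta>"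
    using ball_volume[of r c] r unfolding \<beta>_def measure_def by auto
  have a: "0 < a" "emeasure U ?B = ennreal a" unfolding a_def using r by (auto simp: u.measure_ball_pos u.emeasure_ball_eq)
  have b: "0 < b" "emeasure S ?B = ennreal b" unfolding b_def using r by (auto simp: s.measure_ball_pos s.emeasure_ball_eq)
  have avg_u: "avg ?B u = ennreal (a / \<beta>)" and avg_s: "avg ?B s = ennreal (b / \<beta>)"
    unfolding avg_def u.emeasure_ball_density[symmetric] s.emeasure_ball_density[symmetric]
    using a b \<beta> by (simp_all add: divide_ennreal)
  define E where "E = {y \<in> ?B. ennreal \<delta> * avg ?B u \<le> u y \<and> ennreal \<delta> * avg ?B s \<le> s y}"
  have [measurable]: "E \<in> sets lebesgue" unfolding E_def by measurable
  have third: "4 * (1 / (2 * 3 ^ CARD('n))) \<le> (1 :: real)"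
  proof -
    have "(3 :: real) ^ 1 \<le> 3 ^ CARD('n)" by (intro power_increasing) (auto simp: Suc_le_eq)
    then show ?thesis by (simp add: divide_le_eq)
  qed
  have E: "ennreal (\<beta> / 2) \<le> emeasure lebesgue E"
  proof -
    have "emeasure lebesgue ?B \<le> 2 * emeasure lebesgue E"
      unfolding E_def using \<beta> third by (intro fat_on_pair[OF u.fat[OF r] s.fat[OF r]]) auto
    then have "ennreal (1 / 2) * ennreal \<beta> \<le> ennreal (1 / 2) * (2 * emeasure lebesgue E)"
      unfolding \<beta> by (rule mult_left_mono) simp
    also have "\<dots> = ennreal (1 / 2 * 2) * emeasure lebesgue E"
      by (subst ennreal_mult) (auto simp: mult.assoc)
    finally have "ennreal (1 / 2) * ennreal \<beta> \<le> emeasure lebesgue E" by simp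
    moreover have "ennreal (1 / 2) * ennreal \<beta> = ennreal (1 / 2 * \<beta>)"
      using \<beta> by (intro ennreal_mult[symmetric]) auto
    ultimately show ?thesis by (simp only: mult_1 times_divide_eq_left)
  qed
  \<comment> \<open>A lower bound for s^(1/p') u^(1/p) on \<open>E\<close>. The exponents add up to
    1, so the volume \<beta> enters as \<open>1 / \<beta>\<close> and cancels against the measure of
    \<open>E\<close>.\<close>
  define \<kappa> where "\<kappa> = (\<delta> * (b / \<beta>)) powr (1 / p') * (\<delta> * (a / \<beta>)) powr (1 / p)"
  have \<kappa>: "0 \<le> \<kappa>" unfolding \<kappa>_def by simp
  have \<kappa>_eq: "\<kappa> = \<delta> / \<beta> * (b powr (1 / p') * a powr (1 / p))"
  proof -
    have "\<kappa> = (\<delta> / \<beta>) powr (1 / p') * (\<delta> / \<beta>) powr (1 / p) * (b powr (1 / p') * a powr (1 / p))"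
      unfolding \<kappa>_def using u.\<delta> \<beta> a b by (simp add: powr_mult powr_divide)
    also have "(\<delta> / \<beta>) powr (1 / p') * (\<delta> / \<beta>) powr (1 / p) = \<delta> / \<beta>"
      using u.\<delta> \<beta> conj by (simp add: add.commute flip: powr_add)
    finally show ?thesis .
  qed
  have pw: "AE y in lebesgue. epowr m (p - 1) * ennreal \<kappa> * indicator E y \<le> u y * (interm g y * indicator ?B y)"
    using u.AE_finite
  proof eventually_elim
    case (elim y)
    show ?case
    proof (cases "y \<in> E")
      case True
      then have y: "y \<in> ?B" "ennreal (\<delta> * (a / \<beta>)) \<le> u y" "ennreal (\<delta> * (b / \<beta>)) \<le> s y"
        using ennreal_mult[of \<delta> "a / \<beta>"] ennreal_mult[of \<delta> "b / \<beta>"] u.\<delta> a(1) b(1) \<beta>(1)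
        unfolding E_def avg_u avg_s by simp_all
      \<comment> \<open>Cancelling \<open>u y\<close> in \<open>s y / u y\<close> is legitimate only
        where \<open>u y\<close> is neither 0 nor infinite.\<close>
      have "0 < \<delta> * (a / \<beta>)" using u.\<delta> a \<beta> by simp
      then have u0: "u y \<noteq> 0" using y(2) by auto
      have "s y / u y * u y = s y" using u0 elim by (simp add: ennreal_divide_times less_top)
      then have "epowr (s y) (1 / p') = epowr (s y / u y) (1 / p') * epowr (u y) (1 / p')"
        using p' by (metis epowr_mult less_trans zero_less_divide_1_iff zero_less_one)
      moreover have "epowr (u y) (1 / p') * epowr (u y) (1 / p) = u y"
        using elim p p' conj u0
        by (cases "u y") (auto simp: epowr_ennreal add.commute simp flip: ennreal_mult powr_add)
      ultimately have *: "epowr (s y) (1 / p') * epowr (u y) (1 / p) = epowr (s y / u y) (1 / p') * u y"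
        by (simp add: mult.assoc)
      have "ennreal \<kappa> = epowr (ennreal (\<delta> * (b / \<beta>))) (1 / p') * epowr (ennreal (\<delta> * (a / \<beta>))) (1 / p)"
        unfolding \<kappa>_def using u.\<delta> a b \<beta> p p' by (simp add: epowr_ennreal ennreal_mult)
      also have "\<dots> \<le> epowr (s y) (1 / p') * epowr (u y) (1 / p)"
        using y p p' by (intro mult_mono epowr_mono) auto
      finally have "ennreal \<kappa> \<le> epowr (s y / u y) (1 / p') * u y" unfolding * .
      moreover have "epowr m (p - 1) \<le> epowr (max_op S g y) (p - 1)"
        unfolding m_def using p r y(1) by (intro epowr_mono max_op_upper) auto
      ultimately have "epowr m (p - 1) * ennreal \<kappa> \<le> epowr (max_op S g y) (p - 1) * (epowr (s y / u y) (1 / p') * u y)"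
        by (intro mult_mono) auto
      then show ?thesis using True y(1) by (simp add: interm_def mult_ac)
    qed simp
  qed
  have "epowr m (p - 1) * ennreal \<kappa> * ennreal (\<beta> / 2) \<le> epowr m (p - 1) * ennreal \<kappa> * emeasure lebesgue E"
    using E by (rule mult_left_mono) simp
  also have "\<dots> = (\<integral>\<^sup>+y. epowr m (p - 1) * ennreal \<kappa> * indicator E y \<partial>lebesgue)"
    by (rule nn_integral_cmult_indicator[symmetric]) simp
  also have "\<dots> \<le> (\<integral>\<^sup>+y. u y * (interm g y * indicator ?B y) \<partial>lebesgue)"
    using pw by (rule nn_integral_mono_AE)
  also have "\<dots> = (\<integral>\<^sup>+y\<in>?B. interm g y \<partial>U)"
    by (subst nn_integral_density) auto
  finally have *: "epowr m (p - 1) * ennreal \<kappa> * ennreal (\<beta> / 2) \<le> (\<integral>\<^sup>+y\<in>?B. interm g y \<partial>U)" .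
  have "epowr m (p - 1) * ennreal (\<kappa> * (\<beta> / 2)) \<le> (\<integral>\<^sup>+y\<in>?B. interm g y \<partial>U)"
  proof -
    have "ennreal (\<kappa> * (\<beta> / 2)) = ennreal \<kappa> * ennreal (\<beta> / 2)"
      using \<kappa> \<beta>(1) by (intro ennreal_mult) auto
    then show ?thesis using * by (simp only: mult.assoc)
  qed
  then have "ennreal (2 / \<delta> / a) * (epowr m (p - 1) * ennreal (\<kappa> * (\<beta> / 2)))
      \<le> ennreal (2 / \<delta> / a) * (\<integral>\<^sup>+y\<in>?B. interm g y \<partial>U)"
    by (rule mult_left_mono) simp
  also have "\<dots> = ennreal (2 / \<delta>) * ((\<integral>\<^sup>+y\<in>?B. interm g y \<partial>U) / ennreal a)"
  proof -
    have "ennreal (2 / \<delta> / a) = ennreal (2 / \<delta>) * inverse (ennreal a)"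
      using a u.\<delta> by (simp add: inverse_ennreal divide_inverse flip: ennreal_mult)
    then show ?thesis by (simp add: divide_ennreal_def mult_ac)
  qed
  also have "\<dots> \<le> ennreal (2 / \<delta>) * max_op U (interm g) x"
    unfolding a(2)[symmetric] using r x by (intro mult_left_mono max_op_upper) auto
  finally have *: "ennreal (2 / \<delta> / a) * (epowr m (p - 1) * ennreal (\<kappa> * (\<beta> / 2))) \<le> ennreal (2 / \<delta>) * max_op U (interm g) x" .
  have "epowr m (p - 1) * ennreal (2 / \<delta> / a * (\<kappa> * (\<beta> / 2))) \<le> ennreal (2 / \<delta>) * max_op U (interm g) x"
  proof -
    have "ennreal (2 / \<delta> / a * (\<kappa> * (\<beta> / 2))) = ennreal (2 / \<delta> / a) * ennreal (\<kappa> * (\<beta> / 2))"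
      using a(1) u.\<delta> \<kappa> \<beta>(1) by (intro ennreal_mult) auto
    then show ?thesis using * by (simp only: mult.left_commute)
  qed
  moreover have "2 / \<delta> / a * (\<kappa> * (\<beta> / 2)) = (b / a) powr (1 / p')"
  proof -
    have "2 / \<delta> / a * (\<kappa> * (\<beta> / 2)) = b powr (1 / p') * (a powr (1 / p) / a)"
      unfolding \<kappa>_eq using u.\<delta> \<beta> a by (simp add: field_simps)
    also have "a powr (1 / p) / a = a powr (1 / p - 1)" using a by (simp add: powr_diff)
    also have "1 / p - 1 = - (1 / p')" using conj by simp
    finally show ?thesis using a b by (simp add: powr_minus powr_divide field_simps)
  qed
  ultimately show ?thesis unfolding m_def a_def b_def by simp
qed

text \<open>Here \<open>p' * (p - 1) = p\<close>, and \<open>s x / u x * u x \<le> s x\<close> holds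
  everywhere, because the left side is 0 where \<open>u x\<close> is 0 or infinite.\<close>

lemma interm_norm:
  "(\<integral>\<^sup>+x. epowr (interm g x) p' \<partial>U) \<le> (\<integral>\<^sup>+x. epowr (max_op S g x) p \<partial>S)"
proof -
  have [measurable]: "max_op S g \<in> borel_measurable lebesgue"
    using s.max_op_measurable[of g] by simp
  have "(\<integral>\<^sup>+x. epowr (interm g x) p' \<partial>U) = (\<integral>\<^sup>+x. u x * epowr (interm g x) p' \<partial>lebesgue)"
    by (rule nn_integral_density) auto
  also have "\<dots> \<le> (\<integral>\<^sup>+x. s x * epowr (max_op S g x) p \<partial>lebesgue)"
  proof (rule nn_integral_mono)
    fix x
    have "epowr (interm g x) p' = epowr (max_op S g x) p * (s x / u x)"
      unfolding interm_def using p p' by (simp add: epowr_mult epowr_epowr mult.commute)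
    moreover have "s x / u x * u x \<le> s x"
      by (cases "u x = 0 \<or> u x = top") (auto simp: ennreal_divide_times less_top)
    ultimately have "epowr (interm g x) p' * u x \<le> epowr (max_op S g x) p * s x"
      by (simp only: mult.assoc mult_left_mono zero_le)
    then show "u x * epowr (interm g x) p' \<le> s x * epowr (max_op S g x) p"
      by (simp only: mult.commute)
  qed
  also have "\<dots> = (\<integral>\<^sup>+x. epowr (max_op S g x) p \<partial>S)"
    by (rule nn_integral_density[symmetric]) auto
  finally show ?thesis .
qed

lemma max_op_interm_norm:
  assumes [measurable]: "g \<in> borel_measurable lebesgue"
  shows "(\<integral>\<^sup>+x. epowr (max_op U (interm g) x) p' \<partial>U)
    \<le> ennreal (max_const (2 * 3 ^ CARD('n) / \<delta>) p') * (\<integral>\<^sup>+x. epowr (max_op S g x) p \<partial>S)"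
proof -
  have "(\<integral>\<^sup>+x. epowr (max_op U (interm g) x) p' \<partial>U)
    \<le> ennreal (max_const (2 * 3 ^ CARD('n) / \<delta>) p') * (\<integral>\<^sup>+x. epowr (interm g x) p' \<partial>U)"
    using p' by (intro u.max_op_strong_type) auto
  also have "\<dots> \<le> ennreal (max_const (2 * 3 ^ CARD('n) / \<delta>) p') * (\<integral>\<^sup>+x. epowr (max_op S g x) p \<partial>S)"
    by (intro mult_left_mono interm_norm) auto
  finally show ?thesis .
qed

text \<open>On the whole ball the maximal function is at least the average over that ball.\<close>

lemma average_norm:
  assumes r: "0 < r" and [measurable]: "g \<in> borel_measurable lebesgue"
  shows "epowr ((\<integral>\<^sup>+y\<in>ball c r. g y \<partial>S) / emeasure S (ball c r)) p * emeasure S (ball c r)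
    \<le> (\<integral>\<^sup>+x. epowr (max_op S g x) p \<partial>S)"
proof -
  let ?m = "(\<integral>\<^sup>+y\<in>ball c r. g y \<partial>S) / emeasure S (ball c r)"
  have "epowr ?m p * emeasure S (ball c r) = (\<integral>\<^sup>+x. epowr ?m p * indicator (ball c r) x \<partial>S)"
    by (rule nn_integral_cmult_indicator[symmetric]) simp
  also have "\<dots> \<le> (\<integral>\<^sup>+x. epowr (max_op S g x) p \<partial>S)"
    using p r by (intro nn_integral_mono) (auto intro!: epowr_mono max_op_upper split: split_indicator)
  finally show ?thesis .
qed

end

section \<open>Hedberg's estimate\<close>

lemma suminf_ennreal_geometric:
  assumes "0 \<le> A" "0 \<le> c" "c < 1"
  shows "(\<Sum>j. ennreal (A * c ^ j)) = ennreal (A / (1 - c))"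
proof (rule suminf_ennreal_eq)
  show "0 \<le> A * c ^ j" for j using assms by simp
  have "(\<lambda>j. A * c ^ j) sums (A * (1 / (1 - c)))"
    using assms by (intro sums_mult geometric_sums) simp
  then show "(\<lambda>j. A * c ^ j) sums (A / (1 - c))" by simp
qed

lemma le_suminf_ennreal: "f j \<le> (\<Sum>i. f i :: ennreal)"
  using sum_le_suminf[of f "{j}"] by (simp add: summableI)

lemma inner_shell_ex:
  fixes d :: real
  assumes "0 < d" "d < R"
  shows "\<exists>j::nat. R / 2 ^ j / 2 \<le> d \<and> d < R / 2 ^ j"
proof -
  let ?P = "\<lambda>j::nat. R / 2 ^ j / 2 \<le> d"
  obtain k where "(1 / 2) ^ k < d / R" using real_arch_pow_inv[of "d / R" "1 / 2"] assms by auto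
  then have "R / 2 ^ k < d" using assms by (simp add: field_simps power_divide)
  then have "?P k" using assms(1) by simp
  then have P: "?P (LEAST j. ?P j)" by (rule LeastI)
  show ?thesis
  proof (cases "LEAST j. ?P j")
    case 0 then show ?thesis using P assms by (intro exI[of _ 0]) simp
  next
    case (Suc j)
    then have "\<not> ?P j" by (metis lessI not_less_Least)
    then show ?thesis using P Suc by (intro exI[of _ "Suc j"]) (auto simp: field_simps)
  qed
qed

lemma outer_shell_ex:
  fixes d :: real
  assumes "0 < R" "R \<le> d"
  shows "\<exists>j::nat. 2 ^ j * R \<le> d \<and> d < 2 ^ j * (2 * R)"
proof -
  let ?P = "\<lambda>j::nat. d < 2 ^ j * (2 * R)"
  obtain k where "d / R < 2 ^ k" using real_arch_pow[of 2 "d / R"] by auto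
  then have "d < 2 ^ k * R" using assms by (simp add: field_simps)
  also have "\<dots> \<le> 2 ^ k * (2 * R)" using assms(1) by (intro mult_left_mono) auto
  finally have "?P k" .
  then have P: "?P (LEAST j. ?P j)" by (rule LeastI)
  show ?thesis
  proof (cases "LEAST j. ?P j")
    case 0 then show ?thesis using P assms by (intro exI[of _ 0]) simp
  next
    case (Suc j)
    then have "\<not> ?P j" by (metis lessI not_less_Least)
    then show ?thesis using P Suc by (intro exI[of _ "Suc j"]) (auto simp: field_simps)
  qed
qed

text \<open>A discrete intermediate value argument: reverse doubling makes \<open>a\<close> small at
  a small dyadic radius, and repeated doubling makes it exceed \<open>t\<close> eventually. The
  radius just before the first crossing is the witness.\<close>

lemma scaling_radius_ex:
  fixes a :: "real \<Rightarrow> real"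
  assumes \<rho>: "0 < \<rho>" "\<rho> < 1" and t: "0 < t"
    and pos: "\<And>r. 0 < r \<Longrightarrow> 0 < a r" and decay: "\<And>r. 0 < r \<Longrightarrow> a r \<le> \<rho> * a (2 * r)"
  shows "\<exists>R>0. a R \<le> t \<and> t < a (2 * R)"
proof -
  have up: "a r \<le> \<rho> ^ j * a (2 ^ j * r)" if r: "0 < r" for r and j :: nat
  proof (induction j)
    case (Suc j)
    have "\<rho> ^ j * a (2 ^ j * r) \<le> \<rho> ^ j * (\<rho> * a (2 * (2 ^ j * r)))"
      using \<rho> r by (intro mult_left_mono decay) auto
    then show ?case using Suc by (simp add: mult_ac)
  qed simp
  obtain k where k: "\<rho> ^ k < t / a 1" using real_arch_pow_inv[of "t / a 1" \<rho>] \<rho> t pos[of 1] by auto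
  define r where "r = 1 / (2::real) ^ k"
  have r: "0 < r" unfolding r_def by simp
  have "a r \<le> \<rho> ^ k * a 1" using up[OF r, of k] unfolding r_def by simp
  also have "\<dots> \<le> t" using k pos[of 1] by (simp add: field_simps)
  finally have ar: "a r \<le> t" .
  let ?P = "\<lambda>j::nat. t < a (2 ^ j * r)"
  obtain l where "\<rho> ^ l < a r / t" using real_arch_pow_inv[of "a r / t" \<rho>] \<rho> t pos[OF r] by auto
  then have "\<rho> ^ l * t < a r" using t by (simp add: field_simps)
  also have "\<dots> \<le> \<rho> ^ l * a (2 ^ l * r)" by (rule up[OF r])
  finally have "?P l" using \<rho> by simp
  then have P: "?P (LEAST j. ?P j)" by (rule LeastI)
  then obtain j where j: "(LEAST j. ?P j) = Suc j" using ar by (cases "LEAST j. ?P j") auto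
  then have "\<not> ?P j" by (metis lessI not_less_Least)
  then show ?thesis using P r unfolding j by (intro exI[of _ "2 ^ j * r"]) (auto simp: mult_ac)
qed

text \<open>
  Lets a bound that needs a strictly positive parameter be used when \<open>J = 0\<close>.
\<close>

lemma le_epowr_limit:
  assumes c: "0 < c" and e: "0 < e"
    and bound: "\<And>Z. 0 < Z \<Longrightarrow> J \<le> ennreal (Z powr e) \<Longrightarrow> X \<le> ennreal (c * Z)"
  shows "X \<le> ennreal c * epowr J (1 / e)"
proof (cases J)
  case (real j)
  define z where "z = j powr (1 / e)"
  have z: "0 \<le> z" "z powr e = j" unfolding z_def using real e by (auto simp: powr_powr)
  have "X \<le> ennreal (c * z)"
  proof (rule ennreal_le_epsilon)
    fix \<epsilon> :: real assume \<epsilon>: "0 < \<epsilon>"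
    have "j \<le> (z + \<epsilon> / c) powr e"
      unfolding z(2)[symmetric] using z(1) e c \<epsilon> by (intro powr_mono2) auto
    then have "X \<le> ennreal (c * (z + \<epsilon> / c))"
      using z(1) c \<epsilon> real by (intro bound) (auto intro: add_nonneg_pos ennreal_leI)
    also have "c * (z + \<epsilon> / c) = c * z + \<epsilon>" using c by (simp add: field_simps)
    also have "ennreal (c * z + \<epsilon>) = ennreal (c * z) + ennreal \<epsilon>" using c z \<epsilon> by simp
    finally show "X \<le> ennreal (c * z) + ennreal \<epsilon>" .
  qed
  then show ?thesis using real e c by (simp add: epowr_ennreal z_def ennreal_mult)
next
  case top
  then show ?thesis using c e by (simp add: ennreal_mult_top)
qed

text \<open>\<open>2 powr s\<close> compares the kernel at the inner and outer radius of a shell.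
  The two fractions sum the geometric series over the inner and the outer shells; the first requires
  p < q.\<close>

definition hedberg_const :: "real \<Rightarrow> real \<Rightarrow> real \<Rightarrow> real \<Rightarrow> real" where
  "hedberg_const \<rho> s p q =
     2 powr s * (1 / (1 - \<rho> powr (1 / p - 1 / q)) + 1 / (1 - \<rho> powr (1 / q)))"

text \<open>On a shell the kernel cancels \<open>r powr s\<close> up to a constant, leaving powers
  of the mass \<open>a r\<close>. Inside the balancing radius the bound with \<open>Y\<close> leaves
  the positive power 1/p - 1/q, which decays towards the centre; outside, the bound with
  \<open>G\<close> leaves the power -1/q, which decays outwards. Both decay rates come from reverse
  doubling of \<open>a\<close>.\<close>

lemma hedberg:
  fixes f :: "real ^ 'n \<Rightarrow> ennreal" and a :: "real \<Rightarrow> real"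
  assumes f [measurable]: "f \<in> borel_measurable lebesgue"
    and pq: "0 < p" "p < q" and s: "0 < s" and \<rho>: "0 < \<rho>" "\<rho> < 1"
    and pos: "\<And>r. 0 < r \<Longrightarrow> 0 < a r" and decay: "\<And>r. 0 < r \<Longrightarrow> a r \<le> \<rho> * a (2 * r)"
    and K: "0 \<le> K" and G: "0 < G" and Y: "0 < Y"
    and F: "\<And>r. 0 < r \<Longrightarrow> (\<integral>\<^sup>+y\<in>ball x r. f y \<partial>lebesgue)
      \<le> ennreal (K * r powr s * a r powr - (1 / q) * min G (Y * a r powr (1 / p)))"
  shows "(\<integral>\<^sup>+y. f y * ennreal (norm (x - y) powr - s) \<partial>lebesgue)
    \<le> ennreal (hedberg_const \<rho> s p q * K * G powr (1 - p / q) * Y powr (p / q))"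
proof -
  \<comment> \<open>the mass at which the two arguments of \<^const>\<open>min\<close> balance\<close>
  define t where "t = (G / Y) powr p"
  have t: "0 < t" unfolding t_def using G Y by simp
  obtain R where R: "0 < R" "a R \<le> t" "t < a (2 * R)"
    using scaling_radius_ex[where a=a, OF \<rho> t pos decay] by auto
  have inner: "a (R / 2 ^ j) \<le> \<rho> ^ j * t" for j :: nat
  proof (induction j)
    case (Suc j)
    have "a (R / 2 ^ Suc j) \<le> \<rho> * a (2 * (R / 2 ^ Suc j))" using R by (intro decay) auto
    also have "2 * (R / 2 ^ Suc j) = R / 2 ^ j" by simp
    also have "\<rho> * a (R / 2 ^ j) \<le> \<rho> * (\<rho> ^ j * t)" using Suc \<rho> by (intro mult_left_mono) auto
    finally show ?case by (simp add: mult.assoc)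
  qed (use R in simp)
  have outer: "t \<le> \<rho> ^ j * a (2 ^ j * (2 * R))" for j :: nat
  proof (induction j)
    case (Suc j)
    have "\<rho> ^ j * a (2 ^ j * (2 * R)) \<le> \<rho> ^ j * (\<rho> * a (2 * (2 ^ j * (2 * R))))"
      using \<rho> R by (intro mult_left_mono decay) auto
    then show ?case using Suc by (simp add: mult_ac)
  qed (use R in simp)
  define \<beta> where "\<beta> = 1 / p - 1 / q"
  have \<beta>: "0 < \<beta>" unfolding \<beta>_def using pq by (simp add: frac_less2)
  define c1 where "c1 = \<rho> powr \<beta>"
  define c2 where "c2 = \<rho> powr (1 / q)"
  have c: "0 < c1" "c1 < 1" "0 < c2" "c2 < 1"
    unfolding c1_def c2_def using \<rho> \<beta> pq powr_less_mono2[of \<beta> \<rho> 1] powr_less_mono2[of "1 / q" \<rho> 1] by auto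
  have half: "ennreal ((r / 2) powr - s) * ennreal (K * r powr s * E * M) = ennreal (2 powr s * K * (E * M))"
    if "0 < r" for r E M
  proof -
    have "(r / 2) powr - s * (K * r powr s * E * M) = 2 powr s * K * (E * M)"
      using that by (simp add: powr_divide powr_minus field_simps)
    then show ?thesis unfolding ennreal_mult'[OF powr_ge_zero, symmetric] by (rule arg_cong)
  qed
  define A where "A = 2 powr s * K * (Y * t powr \<beta>)"
  define B where "B = 2 powr s * K * (G * t powr - (1 / q))"
  have AB: "0 \<le> A" "0 \<le> B" unfolding A_def B_def using K Y G by auto
  let ?in = "\<lambda>j::nat. ennreal ((R / 2 ^ j / 2) powr - s)"
  let ?out = "\<lambda>j::nat. ennreal ((2 ^ j * (2 * R) / 2) powr - s)"
  have in_le: "?in j * (\<integral>\<^sup>+y\<in>ball x (R / 2 ^ j). f y \<partial>lebesgue) \<le> ennreal (A * c1 ^ j)" for j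
  proof -
    let ?r = "R / 2 ^ j"
    have r: "0 < ?r" using R by simp
    have "?in j * (\<integral>\<^sup>+y\<in>ball x ?r. f y \<partial>lebesgue)
      \<le> ?in j * ennreal (K * ?r powr s * a ?r powr - (1 / q) * min G (Y * a ?r powr (1 / p)))"
      using F[OF r] by (rule mult_left_mono) simp
    also have "\<dots> = ennreal (2 powr s * K * (a ?r powr - (1 / q) * min G (Y * a ?r powr (1 / p))))"
      by (rule half[OF r])
    also have "\<dots> \<le> ennreal (2 powr s * K * (a ?r powr - (1 / q) * (Y * a ?r powr (1 / p))))"
      using K by (intro ennreal_leI mult_left_mono) auto
    also have "a ?r powr - (1 / q) * (Y * a ?r powr (1 / p)) = Y * a ?r powr \<beta>"
      unfolding \<beta>_def by (simp add: powr_diff powr_minus field_simps)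
    also have "ennreal (2 powr s * K * (Y * a ?r powr \<beta>)) \<le> ennreal (2 powr s * K * (Y * (\<rho> ^ j * t) powr \<beta>))"
      using K Y \<beta> inner[of j] pos[OF r] by (intro ennreal_leI mult_left_mono powr_mono2) auto
    also have "(\<rho> ^ j * t) powr \<beta> = t powr \<beta> * c1 ^ j"
      unfolding c1_def using \<rho> t by (simp add: powr_mult powr_powr mult.commute flip: powr_realpow)
    finally show ?thesis unfolding A_def by (simp add: mult.assoc)
  qed
  have out_le: "?out j * (\<integral>\<^sup>+y\<in>ball x (2 ^ j * (2 * R)). f y \<partial>lebesgue) \<le> ennreal (B * c2 ^ j)" for j
  proof -
    let ?r = "2 ^ j * (2 * R)"
    have r: "0 < ?r" using R by simp
    have "?out j * (\<integral>\<^sup>+y\<in>ball x ?r. f y \<partial>lebesgue)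
      \<le> ?out j * ennreal (K * ?r powr s * a ?r powr - (1 / q) * min G (Y * a ?r powr (1 / p)))"
      using F[OF r] by (rule mult_left_mono) simp
    also have "\<dots> = ennreal (2 powr s * K * (a ?r powr - (1 / q) * min G (Y * a ?r powr (1 / p))))"
      by (rule half[OF r])
    also have "\<dots> \<le> ennreal (2 powr s * K * (a ?r powr - (1 / q) * G))"
      using K by (intro ennreal_leI mult_left_mono) auto
    also have "\<dots> \<le> ennreal (2 powr s * K * ((t / \<rho> ^ j) powr - (1 / q) * G))"
    proof -
      have "t / \<rho> ^ j \<le> a ?r" using outer[of j] \<rho> by (simp add: divide_le_eq mult.commute)
      then have "a ?r powr - (1 / q) \<le> (t / \<rho> ^ j) powr - (1 / q)"
        using t \<rho> pq by (intro powr_mono2') auto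
      then show ?thesis using K G by (intro ennreal_leI mult_left_mono mult_right_mono) auto
    qed
    also have "(t / \<rho> ^ j) powr - (1 / q) = t powr - (1 / q) * c2 ^ j"
    proof -
      have "(t / \<rho> ^ j) powr - (1 / q) = t powr - (1 / q) * (\<rho> ^ j) powr (1 / q)"
        using t \<rho> by (simp add: powr_divide powr_minus field_simps)
      also have "(\<rho> ^ j) powr (1 / q) = c2 ^ j"
        unfolding c2_def using \<rho> by (simp add: powr_powr mult.commute flip: powr_realpow)
      finally show ?thesis .
    qed
    finally show ?thesis unfolding B_def by (simp add: mult_ac)
  qed
  have kernel: "ennreal (norm (x - y) powr - s)
    \<le> (\<Sum>j. ?in j * indicator (ball x (R / 2 ^ j)) y + ?out j * indicator (ball x (2 ^ j * (2 * R))) y)" for y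
  proof -
    define d where "d = norm (x - y)"
    consider "d = 0" | "0 < d" "d < R" | "R \<le> d" unfolding d_def by fastforce
    then have "\<exists>j. ennreal (d powr - s) \<le> ?in j * indicator (ball x (R / 2 ^ j)) y + ?out j * indicator (ball x (2 ^ j * (2 * R))) y"
    proof cases
      \<comment> \<open>Since \<open>0 powr - s = 0\<close>, the singular point of the kernel
        contributes nothing.\<close>
      case 1 then show ?thesis by simp
    next
      case 2
      then obtain j :: nat where j: "R / 2 ^ j / 2 \<le> d" "d < R / 2 ^ j" using inner_shell_ex by blast
      then have "d powr - s \<le> (R / 2 ^ j / 2) powr - s" using s R by (intro powr_mono2') auto
      moreover have "y \<in> ball x (R / 2 ^ j)" using j unfolding d_def by (simp add: dist_norm)
      ultimately show ?thesis by (intro exI[of _ j]) (auto intro!: add_increasing2 ennreal_leI)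
    next
      case 3
      then obtain j :: nat where j: "2 ^ j * R \<le> d" "d < 2 ^ j * (2 * R)" using outer_shell_ex R(1) by blast
      then have "d powr - s \<le> (2 ^ j * (2 * R) / 2) powr - s" using s R by (intro powr_mono2') auto
      moreover have "y \<in> ball x (2 ^ j * (2 * R))" using j unfolding d_def by (simp add: dist_norm)
      ultimately show ?thesis by (intro exI[of _ j]) (auto intro!: add_increasing ennreal_leI)
    qed
    then obtain j where "ennreal (d powr - s) \<le> ?in j * indicator (ball x (R / 2 ^ j)) y + ?out j * indicator (ball x (2 ^ j * (2 * R))) y"
      by blast
    also have "\<dots> \<le> (\<Sum>j. ?in j * indicator (ball x (R / 2 ^ j)) y + ?out j * indicator (ball x (2 ^ j * (2 * R))) y)"
      by (rule le_suminf_ennreal)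
    finally show ?thesis unfolding d_def .
  qed
  have "(\<integral>\<^sup>+y. f y * ennreal (norm (x - y) powr - s) \<partial>lebesgue)
    \<le> (\<integral>\<^sup>+y. (\<Sum>j. f y * (?in j * indicator (ball x (R / 2 ^ j)) y + ?out j * indicator (ball x (2 ^ j * (2 * R))) y)) \<partial>lebesgue)"
    unfolding ennreal_suminf_cmult by (intro nn_integral_mono mult_left_mono kernel) auto
  also have "\<dots> = (\<Sum>j. \<integral>\<^sup>+y. f y * (?in j * indicator (ball x (R / 2 ^ j)) y + ?out j * indicator (ball x (2 ^ j * (2 * R))) y) \<partial>lebesgue)"
    by (rule nn_integral_suminf) measurable
  also have "\<dots> = (\<Sum>j. ?in j * (\<integral>\<^sup>+y\<in>ball x (R / 2 ^ j). f y \<partial>lebesgue)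
      + ?out j * (\<integral>\<^sup>+y\<in>ball x (2 ^ j * (2 * R)). f y \<partial>lebesgue))"
  proof (rule suminf_cong)
    fix j
    have "(\<integral>\<^sup>+y. f y * (?in j * indicator (ball x (R / 2 ^ j)) y + ?out j * indicator (ball x (2 ^ j * (2 * R))) y) \<partial>lebesgue)
      = (\<integral>\<^sup>+y. ?in j * (f y * indicator (ball x (R / 2 ^ j)) y) + ?out j * (f y * indicator (ball x (2 ^ j * (2 * R))) y) \<partial>lebesgue)"
      by (intro nn_integral_cong) (simp only: distrib_left mult.left_commute)
    also have "\<dots> = ?in j * (\<integral>\<^sup>+y\<in>ball x (R / 2 ^ j). f y \<partial>lebesgue)
      + ?out j * (\<integral>\<^sup>+y\<in>ball x (2 ^ j * (2 * R)). f y \<partial>lebesgue)"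
      by (subst nn_integral_add, simp, simp, subst nn_integral_cmult, simp, subst nn_integral_cmult, simp, rule refl)
    finally show "(\<integral>\<^sup>+y. f y * (?in j * indicator (ball x (R / 2 ^ j)) y + ?out j * indicator (ball x (2 ^ j * (2 * R))) y) \<partial>lebesgue) = \<dots>" .
  qed
  also have "\<dots> \<le> (\<Sum>j. ennreal (A * c1 ^ j) + ennreal (B * c2 ^ j))"
    by (intro suminf_le add_mono in_le out_le summableI)
  also have "\<dots> = ennreal (A / (1 - c1)) + ennreal (B / (1 - c2))"
    using AB c by (subst suminf_add[symmetric]) (simp_all only: summableI suminf_ennreal_geometric less_imp_le)
  also have "\<dots> = ennreal (A / (1 - c1) + B / (1 - c2))"
    using AB c by (intro ennreal_plus[symmetric]) auto
  also have "A / (1 - c1) + B / (1 - c2) = hedberg_const \<rho> s p q * K * G powr (1 - p / q) * Y powr (p / q)"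
  proof -
    \<comment> \<open>The choice of \<open>t\<close> makes the leading terms of both series equal to
      the same product of powers of \<open>G\<close> and \<open>Y\<close>.\<close>
    have "Y * t powr \<beta> = G powr (1 - p / q) * Y powr (p / q)"
    proof -
      have "p * \<beta> = 1 - p / q" unfolding \<beta>_def using pq by (simp add: field_simps)
      then have "Y * t powr \<beta> = G powr (1 - p / q) * (Y / Y powr (1 - p / q))"
        unfolding t_def using G Y by (simp add: powr_powr powr_divide)
      also have "Y / Y powr (1 - p / q) = Y powr (p / q)" using Y by (simp add: powr_diff)
      finally show ?thesis .
    qed
    moreover have "G * t powr - (1 / q) = G powr (1 - p / q) * Y powr (p / q)"
    proof -
      have "t powr - (1 / q) = (G / Y) powr - (p / q)"
        unfolding t_def using G Y by (simp add: powr_powr)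
      also have "\<dots> = Y powr (p / q) / G powr (p / q)" using G Y by (simp add: powr_divide powr_minus)
      finally have "G * t powr - (1 / q) = G / G powr (p / q) * Y powr (p / q)" by simp
      also have "G / G powr (p / q) = G powr (1 - p / q)" using G by (simp add: powr_diff)
      finally show ?thesis .
    qed
    ultimately show ?thesis
      unfolding A_def B_def hedberg_const_def c1_def c2_def \<beta>_def
      by (simp add: algebra_simps)
  qed
  finally show ?thesis .
qed

lemma hedberg_const_pos:
  assumes "0 < p" "p < q" "0 < \<rho>" "\<rho> < 1"
  shows "0 < hedberg_const \<rho> s p q"
proof -
  have "0 < 1 / p - 1 / q" using assms by (simp add: frac_less2)
  then have "\<rho> powr (1 / p - 1 / q) < 1" "\<rho> powr (1 / q) < 1"
    using assms powr_less_mono2[of "1 / p - 1 / q" \<rho> 1] powr_less_mono2[of "1 / q" \<rho> 1] by auto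
  then show ?thesis unfolding hedberg_const_def by (intro mult_pos_pos add_pos_pos) auto
qed

section \<open>Weighted bounds for the operators\<close>

lemma powr_le_powr_cancel: "0 < e \<Longrightarrow> 0 \<le> x \<Longrightarrow> 0 \<le> y \<Longrightarrow> x powr e \<le> y powr e \<Longrightarrow> x \<le> (y :: real)"
  using powr_less_mono2[of e y x] by (meson not_le)

lemma max_const_pos: "0 < D \<Longrightarrow> 1 < p \<Longrightarrow> 0 < max_const D p"
  using powr_less_mono[of "1 - p" 0 2] unfolding max_const_def by (intro mult_pos_pos divide_pos_pos) auto

text \<open>The first factor is the cost of \<open>max_op U\<close> on L^p'(U), including the
  \<open>2 / \<delta>\<close> of \<open>interm_lower\<close>; the second is the cost of
  \<open>max_op S\<close> on L^p(S).\<close>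

definition op_const :: "nat \<Rightarrow> real \<Rightarrow> real \<Rightarrow> real \<Rightarrow> real \<Rightarrow> real" where
  "op_const n \<delta> p p' q = ((2 / \<delta>) powr p' * max_const (2 * 3 ^ n / \<delta>) p') powr (1 / q)
     * max_const (2 * 3 ^ n / \<delta>) p powr (1 / p)"

text \<open>The powers of \<delta> come from \<open>fat_on_two_weight_bound\<close>; the volume of
  the unit ball converts volumes of balls into powers of the radius.\<close>

definition test_const :: "nat \<Rightarrow> real \<Rightarrow> real \<Rightarrow> real \<Rightarrow> real" where
  "test_const n \<delta> p' q = (unit_ball_vol (real n) / \<delta>) powr (1 / q + 1 / p')"

lemma test_const_pos:
  assumes "0 < \<delta>"
  shows "0 < test_const n \<delta> p' q"
proof -
  have "0 < unit_ball_vol (real n) / \<delta>" using assms by simp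
  then show ?thesis unfolding test_const_def by (metis less_irrefl powr_gt_zero)
qed

lemma op_const_pos:
  assumes "0 < \<delta>" "1 < p" "1 < p'"
  shows "0 < op_const n \<delta> p p' q"
  unfolding op_const_def using assms max_const_pos[of "2 * 3 ^ n / \<delta>" p] max_const_pos[of "2 * 3 ^ n / \<delta>" p']
  by (intro mult_pos_pos) auto

context two_fat_weights
begin

text \<open>With \<open>t\<close> the \<open>S\<close>-average of \<open>g\<close> and
  \<open>b\<close> the \<open>S\<close>-mass of the ball, the integral is t b = b^(1/p') (t
  b^(1/p)). The two-weight condition bounds the first factor; \<open>average_norm\<close> bounds the
  second by \<open>G\<close>, and \<open>interm_lower\<close> bounds it by \<open>Y\<close> times
  a^(1/p).\<close>

lemma ball_estimate:
  assumes r: "0 < r" and x: "x \<in> ball c r" and [measurable]: "g \<in> borel_measurable lebesgue"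
    and q: "0 < q" and C0: "0 < C0"
    and bound: "AE x in lebesgue. epowr (u x) (1 / q) * epowr (s x) (1 / p') \<le> ennreal C0"
    and G: "0 < G" "(\<integral>\<^sup>+x. epowr (max_op S g x) p \<partial>S) \<le> ennreal (G powr p)"
    and Y: "0 < Y" "ennreal (2 / \<delta>) * max_op U (interm g) x \<le> ennreal (Y powr (p - 1))"
  defines "e \<equiv> 1 / q + 1 / p'"
  shows "(\<integral>\<^sup>+y\<in>ball c r. g y \<partial>S)
    \<le> ennreal (C0 * (unit_ball_vol (real CARD('n)) / \<delta>) powr e * r powr (real CARD('n) * e)
        * measure U (ball c r) powr - (1 / q) * min G (Y * measure U (ball c r) powr (1 / p)))"
proof -
  let ?B = "ball c r"
  define m where "m = (\<integral>\<^sup>+y\<in>?B. g y \<partial>S) / emeasure S ?B"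
  define a where "a = measure U ?B"
  define b where "b = measure S ?B"
  define \<omega> where "\<omega> = unit_ball_vol (real CARD('n))"
  define \<beta> where "\<beta> = \<omega> * r ^ CARD('n)"
  have \<omega>: "0 < \<omega>" unfolding \<omega>_def by simp
  have \<beta>: "0 < \<beta>" "emeasure lebesgue ?B = ennreal \<beta>"
    using ball_volume[of r c] r \<omega> unfolding \<beta>_def \<omega>_def by auto
  have a: "0 < a" "emeasure U ?B = ennreal a" unfolding a_def using r by (auto simp: u.measure_ball_pos u.emeasure_ball_eq)
  have b: "0 < b" "emeasure S ?B = ennreal b" unfolding b_def using r by (auto simp: s.measure_ball_pos s.emeasure_ball_eq)
  have avg_u: "avg ?B u = ennreal (a / \<beta>)" and avg_s: "avg ?B s = ennreal (b / \<beta>)"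
    unfolding avg_def u.emeasure_ball_density[symmetric] s.emeasure_ball_density[symmetric]
    using a b \<beta> by (simp_all add: divide_ennreal)
  have pp: "0 < p" "0 < p - 1" "0 < p'" "(p - 1) / p = 1 / p'" using p p' conj by (auto simp: field_simps)
  have e: "0 < e" unfolding e_def using q pp by (auto intro: add_pos_pos)
  have mG: "epowr m p * ennreal b \<le> ennreal (G powr p)"
    using average_norm[OF r, of g c] G(2) unfolding m_def b(2)[symmetric] by simp
  have "m \<noteq> top"
  proof
    assume "m = top"
    then show False using mG pp b(1) by (simp add: ennreal_top_mult top_unique)
  qed
  then obtain t where t: "m = ennreal t" "0 \<le> t" by (cases m) auto
  have "t powr p * b \<le> G powr p"
    using mG t pp b(1) by (simp add: epowr_ennreal flip: ennreal_mult)
  then have "(t * b powr (1 / p)) powr p \<le> G powr p"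
    using t b pp by (simp add: powr_mult powr_powr)
  then have tG: "t * b powr (1 / p) \<le> G"
    using t G pp by - (rule powr_le_powr_cancel[of p], auto)
  have "epowr m (p - 1) * ennreal ((b / a) powr (1 / p')) \<le> ennreal (Y powr (p - 1))"
    using interm_lower[OF r x, of g] Y(2) unfolding m_def a_def b_def by simp
  then have "t powr (p - 1) * (b / a) powr (1 / p') \<le> Y powr (p - 1)"
    using t pp by (simp add: epowr_ennreal flip: ennreal_mult)
  \<comment> \<open>Since \<open>(p - 1) / p = 1 / p'\<close>, the whole left side is a power with
    exponent \<open>p - 1\<close>, whose root can be taken.\<close>
  then have "(t * (b / a) powr (1 / p)) powr (p - 1) \<le> Y powr (p - 1)"
    using t pp(4) by (simp add: powr_mult powr_powr)
  then have "t * (b / a) powr (1 / p) \<le> Y"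
    using t Y pp by - (rule powr_le_powr_cancel[of "p - 1"], auto)
  then have tY: "t * b powr (1 / p) \<le> Y * a powr (1 / p)"
    using a b by (simp add: powr_divide field_simps)
  have "4 * (1 / (2 * 3 ^ CARD('n))) \<le> (1 :: real)"
  proof -
    have "(3 :: real) ^ 1 \<le> 3 ^ CARD('n)" by (intro power_increasing) (auto simp: Suc_le_eq)
    then show ?thesis by (simp add: divide_le_eq)
  qed
  then have "epowr (avg ?B u) (1 / q) * epowr (avg ?B s) (1 / p') \<le> ennreal (C0 * \<delta> powr - (1 / q + 1 / p'))"
    using \<beta> u.\<delta> q pp by (intro fat_on_two_weight_bound[OF u.fat[OF r] s.fat[OF r] _ _ _ _ _ _ _ _ _ _ bound]) auto
  then have "ennreal ((a / \<beta>) powr (1 / q) * (b / \<beta>) powr (1 / p')) \<le> ennreal (C0 * \<delta> powr - e)"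
    unfolding avg_u avg_s e_def using a(1) b(1) \<beta>(1) by (simp add: epowr_ennreal_pos ennreal_mult)
  then have "(a / \<beta>) powr (1 / q) * (b / \<beta>) powr (1 / p') \<le> C0 * \<delta> powr - e"
    using C0 by (subst (asm) ennreal_le_iff) auto
  moreover have "(a / \<beta>) powr (1 / q) * (b / \<beta>) powr (1 / p') = a powr (1 / q) * b powr (1 / p') / \<beta> powr e"
    unfolding e_def using a b \<beta> by (simp add: powr_divide powr_add)
  ultimately have ab: "a powr (1 / q) * b powr (1 / p') \<le> C0 * \<delta> powr - e * \<beta> powr e"
    using \<beta> by (simp add: divide_le_eq)
  have "b powr (1 / p') \<le> C0 * \<delta> powr - e * \<beta> powr e * a powr - (1 / q)"
  proof -
    have le: "y \<le> z * (1 / x)" if "x * y \<le> z" "0 < x" for x y z :: real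
      using that by (simp add: pos_le_divide_eq mult.commute)
    then show ?thesis
      unfolding powr_minus_divide[of a] using ab a by (intro le) auto
  qed
  also have "C0 * \<delta> powr - e * \<beta> powr e = C0 * (\<omega> / \<delta>) powr e * r powr (real CARD('n) * e)"
    unfolding \<beta>_def using \<omega> r u.\<delta>
    by (simp add: powr_mult powr_divide powr_minus powr_powr field_simps flip: powr_realpow)
  finally have bK: "b powr (1 / p') \<le> C0 * (\<omega> / \<delta>) powr e * r powr (real CARD('n) * e) * a powr - (1 / q)" .
  have "(\<integral>\<^sup>+y\<in>?B. g y \<partial>S) = m * ennreal b"
    unfolding m_def b(2)[symmetric] using b by (simp add: ennreal_divide_times)
  also have "\<dots> = ennreal (t * b)" using t b by (simp flip: ennreal_mult)
  also have "t * b = b powr (1 / p') * (t * b powr (1 / p))"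
    using b conj by (simp add: add.commute mult_ac flip: powr_add)
  also have "ennreal \<dots> \<le> ennreal (C0 * (\<omega> / \<delta>) powr e * r powr (real CARD('n) * e) * a powr - (1 / q)
      * min G (Y * a powr (1 / p)))"
    using bK tG tY t C0 by (intro ennreal_leI mult_mono) auto
  finally show ?thesis unfolding a_def \<omega>_def .
qed

text \<open>The operator is abstract so that the Riesz potential and the maximal function share one
  argument. Two uses of \<open>le_epowr_limit\<close> replace the positive reals \<open>G\<close>
  and \<open>Y\<close> by the possibly zero or infinite quantities they majorize. The q-th power of
  Y^(p/q) is Y^p, which becomes the p'-th power of the scaled \<open>max_op U (interm g)\<close>;
  its \<open>U\<close>-integral is again controlled by G^p, so the exponents of \<open>G\<close> add
  up to 1.\<close>

lemma norm_bound:
  assumes [measurable]: "g \<in> borel_measurable lebesgue"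
    and q: "p \<le> q" and \<kappa>: "0 < \<kappa>"
    and T: "\<And>x G Y. 0 < G \<Longrightarrow> (\<integral>\<^sup>+x. epowr (max_op S g x) p \<partial>S) \<le> ennreal (G powr p) \<Longrightarrow>
      0 < Y \<Longrightarrow> ennreal (2 / \<delta>) * max_op U (interm g) x \<le> ennreal (Y powr (p - 1)) \<Longrightarrow>
      T x \<le> ennreal (\<kappa> * G powr (1 - p / q) * Y powr (p / q))"
  shows "epowr (\<integral>\<^sup>+x. epowr (T x) q * u x \<partial>lebesgue) (1 / q)
    \<le> ennreal (\<kappa> * op_const CARD('n) \<delta> p p' q) * epowr (\<integral>\<^sup>+x. epowr (g x) p \<partial>S) (1 / p)"
proof -
  have pp: "0 < p" "0 < p - 1" "0 < p'" "0 < q" "(p - 1) / p = 1 / p'" using p p' q conj by (auto simp: field_simps)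
  define D where "D = 2 * 3 ^ CARD('n) / \<delta>"
  have D: "0 < D" unfolding D_def using u.\<delta> by simp
  have mc: "0 < max_const D p" "0 < max_const D p'"
    using max_const_pos[OF D] p p' by auto
  define J where "J = (\<integral>\<^sup>+x. epowr (max_op S g x) p \<partial>S)"
  define H where "H = max_op U (interm g)"
  have [measurable]: "H \<in> borel_measurable lebesgue"
    unfolding H_def using u.max_op_measurable[of "interm g"] by simp
  define X where "X = epowr (\<integral>\<^sup>+x. epowr (T x) q * u x \<partial>lebesgue) (1 / q)"
  define A where "A = ((2 / \<delta>) powr p' * max_const D p') powr (1 / q)"
  have A: "0 < A" unfolding A_def using u.\<delta> mc by simp
  have "X \<le> ennreal (\<kappa> * A) * epowr J (1 / p)"
  proof (rule le_epowr_limit)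
    fix G :: real assume G: "0 < G" "J \<le> ennreal (G powr p)"
    define k where "k = \<kappa> * G powr (1 - p / q)"
    have k: "0 < k" unfolding k_def using \<kappa> G by simp
    have "T x \<le> ennreal k * epowr (ennreal (2 / \<delta>) * H x) (1 / (q / p'))" for x
    proof (rule le_epowr_limit[OF k])
      show "0 < q / p'" using pp by simp
      fix Z :: real assume Z: "0 < Z" "ennreal (2 / \<delta>) * H x \<le> ennreal (Z powr (q / p'))"
      \<comment> \<open>The hypothesis on \<open>T\<close> is used with
        \<open>Y = Z powr (q / p)\<close>, so that Y^(p/q) becomes linear in
        \<open>Z\<close>.\<close>
      have "q / p * (p - 1) = q / p'" using pp(5) by (simp add: divide_inverse mult_ac)
      then have "(Z powr (q / p)) powr (p - 1) = Z powr (q / p')" by (simp only: powr_powr)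
      then have "T x \<le> ennreal (\<kappa> * G powr (1 - p / q) * (Z powr (q / p)) powr (p / q))"
        using Z G unfolding J_def H_def by (intro T) auto
      then show "T x \<le> ennreal (k * Z)" unfolding k_def using Z pp by (simp add: powr_powr)
    qed
    then have "epowr (T x) q \<le> epowr (ennreal k * epowr (ennreal (2 / \<delta>) * H x) (1 / (q / p'))) q" for x
      using pp by (intro epowr_mono) auto
    also have "epowr (ennreal k * epowr (ennreal (2 / \<delta>) * H x) (1 / (q / p'))) q
        = ennreal (k powr q * (2 / \<delta>) powr p') * epowr (H x) p'" for x
      using pp k u.\<delta> by (simp add: epowr_mult epowr_epowr epowr_ennreal powr_powr ennreal_mult mult.assoc)
    finally have Tq: "epowr (T x) q \<le> ennreal (k powr q * (2 / \<delta>) powr p') * epowr (H x) p'" for x .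
    have "(\<integral>\<^sup>+x. epowr (T x) q * u x \<partial>lebesgue)
      \<le> (\<integral>\<^sup>+x. ennreal (k powr q * (2 / \<delta>) powr p') * (u x * epowr (H x) p') \<partial>lebesgue)"
    proof (rule nn_integral_mono)
      fix x
      have "epowr (T x) q * u x \<le> ennreal (k powr q * (2 / \<delta>) powr p') * epowr (H x) p' * u x"
        using Tq by (rule mult_right_mono) simp
      then show "epowr (T x) q * u x \<le> ennreal (k powr q * (2 / \<delta>) powr p') * (u x * epowr (H x) p')"
        by (simp only: mult.assoc mult.commute[of "u x"])
    qed
    also have "\<dots> = ennreal (k powr q * (2 / \<delta>) powr p') * (\<integral>\<^sup>+x. epowr (H x) p' \<partial>U)"
      by (subst nn_integral_cmult, simp, subst nn_integral_density) auto
    also have "\<dots> \<le> ennreal (k powr q * (2 / \<delta>) powr p') * (ennreal (max_const D p') * ennreal (G powr p))"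
    proof (rule mult_left_mono)
      have "(\<integral>\<^sup>+x. epowr (H x) p' \<partial>U) \<le> ennreal (max_const D p') * J"
        unfolding H_def J_def D_def by (rule max_op_interm_norm) simp
      also have "\<dots> \<le> ennreal (max_const D p') * ennreal (G powr p)"
        using G(2) by (rule mult_left_mono) simp
      finally show "(\<integral>\<^sup>+x. epowr (H x) p' \<partial>U) \<le> ennreal (max_const D p') * ennreal (G powr p)" .
    qed simp
    also have "\<dots> = ennreal (k powr q * ((2 / \<delta>) powr p' * max_const D p') * G powr p)"
      using mc by (simp add: ennreal_mult mult.assoc)
    finally have "X \<le> epowr (ennreal (k powr q * ((2 / \<delta>) powr p' * max_const D p') * G powr p)) (1 / q)"
      unfolding X_def using pp by (intro epowr_mono) auto
    also have "\<dots> = ennreal ((k powr q * ((2 / \<delta>) powr p' * max_const D p') * G powr p) powr (1 / q))"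
      using pp mc by (intro epowr_ennreal) auto
    also have "(k powr q * ((2 / \<delta>) powr p' * max_const D p') * G powr p) powr (1 / q)
        = (k powr q) powr (1 / q) * A * (G powr p) powr (1 / q)"
      unfolding A_def using mc by (simp only: powr_mult)
    also have "\<dots> = \<kappa> * A * (G powr (1 - p / q) * G powr (p / q))"
      unfolding k_def using pp k G \<kappa> by (simp add: powr_powr powr_mult)
    also have "G powr (1 - p / q) * G powr (p / q) = G"
      using G by (simp flip: powr_add)
    finally show "X \<le> ennreal (\<kappa> * A * G)" .
  qed (use \<kappa> A pp in auto)
  also have "\<dots> \<le> ennreal (\<kappa> * A) * epowr (ennreal (max_const D p) * (\<integral>\<^sup>+x. epowr (g x) p \<partial>S)) (1 / p)"
    unfolding J_def D_def using pp p by (intro mult_left_mono epowr_mono s.max_op_strong_type) auto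
  also have "\<dots> = ennreal (\<kappa> * (A * max_const D p powr (1 / p))) * epowr (\<integral>\<^sup>+x. epowr (g x) p \<partial>S) (1 / p)"
    using pp mc A \<kappa> by (simp add: epowr_mult epowr_ennreal ennreal_mult mult.assoc)
  finally show ?thesis unfolding X_def A_def D_def op_const_def .
qed

lemma integral_weighted_eq:
  assumes [measurable]: "g \<in> borel_measurable lebesgue"
  shows "(\<integral>\<^sup>+y\<in>ball x r. g y * s y \<partial>lebesgue) = (\<integral>\<^sup>+y\<in>ball x r. g y \<partial>S)"
  by (subst nn_integral_density) (auto simp: mult_ac)

text \<open>\<open>ball_estimate\<close> on balls centred at \<open>x\<close> is the hypothesis of
  \<open>hedberg\<close>, with the \<open>U\<close>-mass of these balls as \<open>a\<close>. The
  exponent \<gamma> is n - \<alpha> under the relation between \<open>p\<close> and \<open>q\<close>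
  in the theorem.\<close>

lemma riesz_weighted_bound:
  assumes [measurable]: "g \<in> borel_measurable lebesgue"
    and q: "p < q" and C0: "0 < C0"
    and bound: "AE x in lebesgue. epowr (u x) (1 / q) * epowr (s x) (1 / p') \<le> ennreal C0"
  defines "\<gamma> \<equiv> real CARD('n) * (1 / q + 1 / p')"
  shows "epowr (\<integral>\<^sup>+x. epowr (\<integral>\<^sup>+y. g y * s y * ennreal (norm (x - y) powr - \<gamma>) \<partial>lebesgue) q * u x \<partial>lebesgue) (1 / q)
    \<le> ennreal (hedberg_const (1 - \<delta> / (2 * 3 ^ CARD('n))) \<gamma> p q * (C0 * test_const CARD('n) \<delta> p' q) * op_const CARD('n) \<delta> p p' q)
      * epowr (\<integral>\<^sup>+x. epowr (g x) p \<partial>S) (1 / p)"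
proof (rule norm_bound)
  show "0 < hedberg_const (1 - \<delta> / (2 * 3 ^ CARD('n))) \<gamma> p q * (C0 * test_const CARD('n) \<delta> p' q)"
    using C0 test_const_pos[OF u.\<delta>(1)] u.decay p q by (intro mult_pos_pos hedberg_const_pos) auto
next
  fix x :: "real ^ 'n" and G Y :: real
  assume G: "0 < G" "(\<integral>\<^sup>+x. epowr (max_op S g x) p \<partial>S) \<le> ennreal (G powr p)"
    and Y: "0 < Y" "ennreal (2 / \<delta>) * max_op U (interm g) x \<le> ennreal (Y powr (p - 1))"
  show "(\<integral>\<^sup>+y. g y * s y * ennreal (norm (x - y) powr - \<gamma>) \<partial>lebesgue)
    \<le> ennreal (hedberg_const (1 - \<delta> / (2 * 3 ^ CARD('n))) \<gamma> p q * (C0 * test_const CARD('n) \<delta> p' q)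
        * G powr (1 - p / q) * Y powr (p / q))"
  proof (rule hedberg[where a="\<lambda>r. measure U (ball x r)"])
    fix r :: real assume r: "0 < r"
    have "0 < q" using p q by simp
    then show "(\<integral>\<^sup>+y\<in>ball x r. g y * s y \<partial>lebesgue) \<le> ennreal (C0 * test_const CARD('n) \<delta> p' q * r powr \<gamma>
        * measure U (ball x r) powr - (1 / q) * min G (Y * measure U (ball x r) powr (1 / p)))"
      using r ball_estimate[OF r _ _ _ C0 bound G Y, of x] unfolding test_const_def \<gamma>_def
      by (subst integral_weighted_eq) simp_all
  next
    show "0 < \<gamma>" unfolding \<gamma>_def using p q p' by (intro mult_pos_pos add_pos_pos) auto
  qed (use p q u.decay u.measure_ball_pos u.measure_ball_decay C0 test_const_pos[OF u.\<delta>(1), of "CARD('n)" p' q] G Y in auto)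
qed (use q in auto)

text \<open>For p = q the second bound in \<open>ball_estimate\<close> cancels the
  \<open>U\<close>-mass of the ball, leaving a multiple of r^n Y, hence averages bounded by a
  multiple of \<open>Y\<close>.\<close>

lemma maximal_weighted_bound:
  assumes [measurable]: "g \<in> borel_measurable lebesgue" and C0: "0 < C0"
    and bound: "AE x in lebesgue. epowr (u x) (1 / p) * epowr (s x) (1 / p') \<le> ennreal C0"
  shows "epowr (\<integral>\<^sup>+x. epowr (SUP Q\<in>{Q \<in> cubes. x \<in> Q}. avg Q (\<lambda>y. g y * s y)) p * u x \<partial>lebesgue) (1 / p)
    \<le> ennreal ((1 + real CARD('n)) ^ CARD('n) * (C0 * test_const CARD('n) \<delta> p' p) * op_const CARD('n) \<delta> p p' p)
      * epowr (\<integral>\<^sup>+x. epowr (g x) p \<partial>S) (1 / p)"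
proof (rule norm_bound)
  show "0 < (1 + real CARD('n)) ^ CARD('n) * (C0 * test_const CARD('n) \<delta> p' p)"
    using C0 test_const_pos[OF u.\<delta>(1)] by (intro mult_pos_pos zero_less_power) auto
next
  fix x :: "real ^ 'n" and G Y :: real
  assume G: "0 < G" "(\<integral>\<^sup>+x. epowr (max_op S g x) p \<partial>S) \<le> ennreal (G powr p)"
    and Y: "0 < Y" "ennreal (2 / \<delta>) * max_op U (interm g) x \<le> ennreal (Y powr (p - 1))"
  define n where "n = CARD('n)"
  have p0: "0 < p" using p by simp
  show "(SUP Q\<in>{Q \<in> cubes. x \<in> Q}. avg Q (\<lambda>y. g y * s y))
    \<le> ennreal ((1 + real CARD('n)) ^ CARD('n) * (C0 * test_const CARD('n) \<delta> p' p) * G powr (1 - p / p) * Y powr (p / p))"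
  proof (rule SUP_least)
    fix Q :: "(real ^ 'n) set" assume "Q \<in> {Q \<in> cubes. x \<in> Q}"
    then obtain c l where Q: "Q \<in> cubes" "x \<in> Q" "Q = cbox c (\<chi> i. c $ i + l)" "0 < l"
      unfolding cubes_def by auto
    \<comment> \<open>Points of \<open>Q\<close> differ from \<open>x\<close> by at most
      \<open>n * l\<close> in the l1 norm; one more \<open>l\<close> gives strict inclusion in the
      open ball.\<close>
    define r where "r = (1 + real n) * l"
    have r: "0 < r" unfolding r_def using Q by simp
    have "Q \<subseteq> ball x r"
    proof
      fix y assume "y \<in> Q"
      then have "\<bar>(x - y) $ i\<bar> \<le> l" for i
        using Q(2) unfolding Q(3) mem_box_cart by (auto simp: abs_le_iff) (smt (verit))+
      then have "norm (x - y) \<le> (\<Sum>i\<in>(UNIV :: 'n set). l)"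
        by (intro order_trans[OF norm_le_l1_cart] sum_mono)
      also have "\<dots> < r" unfolding r_def n_def using Q(4) by (simp add: algebra_simps)
      finally show "y \<in> ball x r" by (simp add: dist_norm)
    qed
    have vol: "emeasure lebesgue Q = ennreal (l ^ n)"
    proof -
      have "measure lebesgue Q = l ^ n"
        using Q(4) unfolding Q(3) n_def by (simp add: content_cbox_cart interval_ne_empty_cart(1) less_imp_le)
      then show ?thesis using cubes_measure(4)[OF Q(1)] by simp
    qed
    define a where "a = measure U (ball x r)"
    have a: "0 < a" unfolding a_def using r by (rule u.measure_ball_pos)
    have "(\<integral>\<^sup>+y\<in>Q. g y * s y \<partial>lebesgue) \<le> (\<integral>\<^sup>+y\<in>ball x r. g y * s y \<partial>lebesgue)"
      using \<open>Q \<subseteq> ball x r\<close> by (intro nn_integral_mono) (auto split: split_indicator)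
    also have "\<dots> \<le> ennreal (C0 * test_const CARD('n) \<delta> p' p * r powr (real n * (1 / p + 1 / p')) * a powr - (1 / p)
        * min G (Y * a powr (1 / p)))"
      using r p0 ball_estimate[OF r _ _ p0 C0 bound G Y, of x] unfolding test_const_def a_def n_def
      by (subst integral_weighted_eq) simp_all
    also have "\<dots> \<le> ennreal (C0 * test_const CARD('n) \<delta> p' p * r ^ n * a powr - (1 / p) * (Y * a powr (1 / p)))"
      using C0 test_const_pos[OF u.\<delta>(1), of "CARD('n)" p' p] r conj
      by (intro ennreal_leI) (auto simp: powr_realpow intro!: mult_left_mono)
    also have "C0 * test_const CARD('n) \<delta> p' p * r ^ n * a powr - (1 / p) * (Y * a powr (1 / p)) = C0 * test_const CARD('n) \<delta> p' p * r ^ n * Y"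
      using a by (simp add: powr_minus field_simps)
    finally have "avg Q (\<lambda>y. g y * s y) \<le> ennreal (C0 * test_const CARD('n) \<delta> p' p * r ^ n * Y) / ennreal (l ^ n)"
      unfolding avg_def vol by (rule divide_right_mono_ennreal)
    also have "\<dots> = ennreal (C0 * test_const CARD('n) \<delta> p' p * r ^ n * Y / l ^ n)"
      using Q(4) C0 test_const_pos[OF u.\<delta>(1), of "CARD('n)" p' p] r Y by (intro divide_ennreal) auto
    also have "C0 * test_const CARD('n) \<delta> p' p * r ^ n * Y / l ^ n
        = (1 + real CARD('n)) ^ CARD('n) * (C0 * test_const CARD('n) \<delta> p' p) * G powr (1 - p / p) * Y powr (p / p)"
      unfolding r_def n_def using Q(4) G Y p0 by (simp add: power_mult_distrib)
    finally show "avg Q (\<lambda>y. g y * s y)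
      \<le> ennreal ((1 + real CARD('n)) ^ CARD('n) * (C0 * test_const CARD('n) \<delta> p' p) * G powr (1 - p / p) * Y powr (p / p))" .
  qed
qed auto

end

section \<open>The theorem\<close>

text \<open>Where the potential converges absolutely this is the triangle inequality for integrals;
  elsewhere both sides are infinite.\<close>

lemma riesz_modulus_le:
  fixes f :: "real ^ 'n \<Rightarrow> complex"
  assumes [measurable]: "f \<in> borel_measurable lebesgue"
  shows "riesz_modulus \<alpha> f x
    \<le> (\<integral>\<^sup>+y. ennreal (cmod (f y)) * ennreal (norm (x - y) powr - (real CARD('n) - \<alpha>)) \<partial>lebesgue)"
proof -
  have "(\<lambda>y. norm (x - y)) \<in> borel_measurable lebesgue"
    by (intro measurable_completion) measurable
  then have [measurable]: "riesz_integrand \<alpha> f x \<in> borel_measurable lebesgue"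
    unfolding riesz_integrand_def by measurable
  \<comment> \<open>At \<open>y = x\<close> both sides vanish: on the left by division by 0, on the
    right because \<open>0 powr\<close> of any exponent is 0.\<close>
  have norm_eq: "ennreal (cmod (riesz_integrand \<alpha> f x y))
      = ennreal (cmod (f y)) * ennreal (norm (x - y) powr - (real CARD('n) - \<alpha>))" for y
    unfolding riesz_integrand_def powr_minus_divide
    by (simp add: norm_divide flip: ennreal_mult)
  show ?thesis
  proof (cases "integrable lebesgue (riesz_integrand \<alpha> f x)")
    case True
    have "ennreal (cmod (riesz_potential \<alpha> f x)) \<le> ennreal (\<integral>y. cmod (riesz_integrand \<alpha> f x y) \<partial>lebesgue)"
      unfolding riesz_potential_def by (intro ennreal_leI integral_norm_bound)
    also have "\<dots> = (\<integral>\<^sup>+y. ennreal (cmod (riesz_integrand \<alpha> f x y)) \<partial>lebesgue)"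
      using True by (intro nn_integral_eq_integral[symmetric]) auto
    finally show ?thesis using True unfolding riesz_modulus_def norm_eq by simp
  next
    case False
    then have "(\<integral>\<^sup>+y. ennreal (cmod (riesz_integrand \<alpha> f x y)) \<partial>lebesgue) = top"
      unfolding integrable_iff_bounded by (simp add: less_top[symmetric])
    then show ?thesis unfolding norm_eq by simp
  qed
qed

text \<open>The dual factor is v^(-1/p), so the pointwise hypothesis becomes a product bound. Where
  \<open>v\<close> is 0 the hypothesis forces \<open>z = 0\<close>, and where \<open>v\<close> is
  infinite the dual factor is 0; the convention 0 \<cdot> \<infinity> = 0 settles the
  former.\<close>

lemma dual_weight_le:
  assumes p: "0 < p" and p': "0 < p'" and C: "0 < C"
    and le: "z \<le> ennreal C * epowr v (1 / p)"
  shows "z * epowr (epowr v (- p' / p)) (1 / p') \<le> ennreal C"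
proof (cases v)
  case (real t)
  show ?thesis
  proof (cases "t = 0")
    case True
    then show ?thesis using le real p by simp
  next
    case False
    then have t: "0 < t" using real by simp
    have "z * epowr (epowr v (- p' / p)) (1 / p') \<le> ennreal C * epowr v (1 / p) * epowr (epowr v (- p' / p)) (1 / p')"
      using le by (rule mult_right_mono) simp
    also have "\<dots> = ennreal (C * (t powr (1 / p) * t powr - (1 / p)))"
      using real t p p' C by (simp add: epowr_ennreal_pos powr_powr ennreal_mult mult.assoc)
    also have "t powr (1 / p) * t powr - (1 / p) = 1"
      using t by (simp flip: powr_add)
    finally show ?thesis by simp
  qed
next
  case top
  then have "epowr v (- p' / p) = 0" using p p' by (simp add: epowr_def divide_neg_pos)
  then show ?thesis using p' by simp
qed

text \<open>For g = c/s one has g^p s = c^p s^(1-p) = c^p v, because (p'/p)(p-1) = 1. Finiteness of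
  \<open>s\<close> excludes v = 0, and finiteness of c^p v forces c = 0 where \<open>v\<close> is
  infinite and \<open>s\<close> vanishes.\<close>

lemma dual_weight_factor:
  fixes c :: real
  assumes p: "1 < p" and conj: "1 / p + 1 / p' = 1" and c: "0 \<le> c"
    and s: "s = epowr v (- p' / p)" "s \<noteq> top" and fin: "epowr (ennreal c) p * v \<noteq> top"
  shows "ennreal c / s * s = ennreal c" "s * epowr (ennreal c / s) p = epowr (ennreal c) p * v"
proof -
  have "1 / p' = 1 - 1 / p" using conj by simp
  then have "0 < 1 / p'" using p by auto
  then have p': "0 < p'" by simp
  have "ennreal c / s * s = ennreal c \<and> s * epowr (ennreal c / s) p = epowr (ennreal c) p * v"
  proof (cases "v = 0 \<or> v = top")
    case True
    then have "v = top" "s = 0" using s p p' by (auto simp: epowr_def divide_neg_pos)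
    then show ?thesis using fin p c by (auto simp: ennreal_mult_eq_top_iff)
  next
    case False
    then obtain t where t: "v = ennreal t" "0 < t" by (cases v) (auto simp: less_le)
    have st: "s = ennreal (t powr (- p' / p))" unfolding s t using t(2) by (rule epowr_ennreal_pos)
    have div: "ennreal c / s = ennreal (c / t powr (- p' / p))"
      unfolding st using t c by (intro divide_ennreal) auto
    have "p' - p' / p = 1"
      using conj p p' by (simp add: field_simps)
    then have "- p' / p + p' = 1" by simp
    moreover have "s * epowr (ennreal c / s) p = ennreal (t powr (- p' / p) * (c / t powr (- p' / p)) powr p)"
      unfolding div using p c t by (simp add: epowr_ennreal st flip: ennreal_mult)
    moreover have "t powr (- p' / p) * (c / t powr (- p' / p)) powr p = c powr p * t powr (- p' / p + p')"
    proof -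
      have "(c / t powr (- p' / p)) powr p = c powr p / t powr - p'"
        using t c p by (simp add: powr_divide powr_powr)
      also have "\<dots> = c powr p * t powr p'" by (simp add: powr_minus_divide)
      finally show ?thesis by (simp only: powr_add mult.left_commute mult.commute)
    qed
    ultimately have "s * epowr (ennreal c / s) p = ennreal (c powr p * t)" using t by simp
    also have "\<dots> = epowr (ennreal c) p * v" using t c p by (simp add: epowr_ennreal ennreal_mult)
    finally have "s * epowr (ennreal c / s) p = epowr (ennreal c) p * v" .
    moreover have "ennreal c / s * s = ennreal c"
      unfolding div by (subst st) (use t c in \<open>simp flip: ennreal_mult\<close>)
    ultimately show ?thesis by blast
  qed
  then show "ennreal c / s * s = ennreal c" "s * epowr (ennreal c / s) p = epowr (ennreal c) p * v"
    by auto
qed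

text \<open>Writing |f| = g \<sigma> turns the right-hand norm into that of \<open>g\<close> in
  L^p(\<sigma>). The cases outside \<open>two_fat_weights\<close> are settled here: an infinite
  right-hand side, \<open>u\<close> zero almost everywhere, and \<sigma> zero almost everywhere,
  where \<open>f\<close> vanishes too. \<open>T_cong\<close> is needed because the factorization
  holds only almost everywhere.\<close>

lemma reduce_to_dual_weight:
  fixes u v \<sigma> :: "real ^ 'n \<Rightarrow> ennreal" and f :: "real ^ 'n \<Rightarrow> complex"
    and T :: "(real ^ 'n \<Rightarrow> ennreal) \<Rightarrow> real ^ 'n \<Rightarrow> ennreal"
  assumes u: "weight_fat_on_balls u \<delta>" and s: "weight_fat_on_balls \<sigma> \<delta>"
    and \<sigma>: "\<sigma> = (\<lambda>x. epowr (v x) (- p' / p))"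
    and [measurable]: "v \<in> borel_measurable lebesgue" "f \<in> borel_measurable lebesgue"
    and p: "1 < p" "1 / p + 1 / p' = 1" and q: "0 < q" and C: "0 < C"
    and T_cong: "\<And>f f' x. (AE y in lebesgue. f y = f' y) \<Longrightarrow> T f x = T f' x"
    and T_zero: "\<And>x. T (\<lambda>y. 0) x = 0"
    and main: "\<And>g. two_fat_weights u \<sigma> \<delta> p p' \<Longrightarrow> g \<in> borel_measurable lebesgue \<Longrightarrow>
      epowr (\<integral>\<^sup>+x. epowr (T (\<lambda>y. g y * \<sigma> y) x) q * u x \<partial>lebesgue) (1 / q)
        \<le> ennreal C * epowr (\<integral>\<^sup>+x. epowr (g x) p \<partial>density lebesgue \<sigma>) (1 / p)"
  shows "weighted_norm q u (T (\<lambda>y. ennreal (cmod (f y))))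
    \<le> ennreal C * weighted_norm p v (\<lambda>y. ennreal (cmod (f y)))"
proof -
  interpret u: weight_fat_on_balls u \<delta> by fact
  interpret s: weight_fat_on_balls \<sigma> \<delta> by fact
  have p0: "0 < p" using p by simp
  let ?F = "\<lambda>y. ennreal (cmod (f y))"
  define N where "N = (\<integral>\<^sup>+x. epowr (?F x) p * v x \<partial>lebesgue)"
  consider "N = top" | "\<exists>c r. 0 < r \<and> (\<integral>\<^sup>+y\<in>ball c r. u y \<partial>lebesgue) = 0" | "N < top"
    "\<forall>c r. 0 < r \<longrightarrow> 0 < (\<integral>\<^sup>+y\<in>ball c r. u y \<partial>lebesgue)"
    by (metis less_top zero_less_iff_neq_zero)
  then show ?thesis
  proof cases
    case 1
    then show ?thesis unfolding weighted_norm_def N_def using C p0 by (simp add: ennreal_mult_top)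
  next
    case 2
    then have "AE x in lebesgue. u x = 0" using u.AE_zero by blast
    then have "AE x in lebesgue. epowr (T ?F x) q * u x = 0" by eventually_elim simp
    then have "(\<integral>\<^sup>+x. epowr (T ?F x) q * u x \<partial>lebesgue) = integral\<^sup>N (lebesgue :: (real ^ 'n) measure) (\<lambda>_. 0)"
      by (rule nn_integral_cong_AE)
    then show ?thesis unfolding weighted_norm_def using q by simp
  next
    case 3
    have "AE x in lebesgue. epowr (?F x) p * v x \<noteq> \<infinity>"
      using 3(1) unfolding N_def by (intro nn_integral_PInf_AE) auto
    then have fact: "AE x in lebesgue. ?F x / \<sigma> x * \<sigma> x = ?F x \<and> \<sigma> x * epowr (?F x / \<sigma> x) p = epowr (?F x) p * v x"
      using s.AE_finite
    proof eventually_elim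
      case (elim x)
      show ?case
        using dual_weight_factor[OF p, of "cmod (f x)" "\<sigma> x" "v x"] elim unfolding \<sigma> by simp
    qed
    define g where "g x = ?F x / \<sigma> x" for x
    have [measurable]: "g \<in> borel_measurable lebesgue" unfolding g_def by measurable
    have T_eq: "T (\<lambda>y. g y * \<sigma> y) x = T ?F x" for x
      using fact unfolding g_def by (intro T_cong) auto
    show ?thesis
    proof (cases "\<exists>c r. 0 < r \<and> (\<integral>\<^sup>+y\<in>ball c r. \<sigma> y \<partial>lebesgue) = 0")
      case True
      then have "AE x in lebesgue. \<sigma> x = 0" using s.AE_zero by blast
      then have "T (\<lambda>y. g y * \<sigma> y) x = T (\<lambda>y. 0) x" for x
        by (intro T_cong) (auto elim: eventually_mono)
      then show ?thesis unfolding weighted_norm_def using q T_eq T_zero by simp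
    next
      case False
      then have "two_fat_weights u \<sigma> \<delta> p p'"
        using 3(2) p by unfold_locales (auto simp: zero_less_iff_neq_zero)
      then have "weighted_norm q u (T ?F)
        \<le> ennreal C * epowr (\<integral>\<^sup>+x. epowr (g x) p \<partial>density lebesgue \<sigma>) (1 / p)"
        unfolding weighted_norm_def T_eq[symmetric] by (rule main) simp
      also have "(\<integral>\<^sup>+x. epowr (g x) p \<partial>density lebesgue \<sigma>) = (\<integral>\<^sup>+x. \<sigma> x * epowr (g x) p \<partial>lebesgue)"
        by (rule nn_integral_density) auto
      also have "\<dots> = (\<integral>\<^sup>+x. epowr (?F x) p * v x \<partial>lebesgue)"
        using fact unfolding g_def by (intro nn_integral_cong_AE) auto
      finally show ?thesis unfolding weighted_norm_def .
    qed
  qed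
qed

lemma A_inf_weight_fat_on_balls:
  assumes "w \<in> A_inf" "0 < \<delta>" "\<delta> < 1" "\<And>x r. 0 < r \<Longrightarrow> fat_on \<delta> (1 / (2 * 3 ^ CARD('n))) (ball x r) w"
  shows "weight_fat_on_balls (w :: real ^ 'n \<Rightarrow> ennreal) \<delta>"
proof
  show "w \<in> borel_measurable lebesgue" using assms(1) unfolding A_inf_def weight_def by auto
  show "(\<integral>\<^sup>+y\<in>ball x r. w y \<partial>lebesgue) < top" for x r
  proof -
    have "(\<integral>\<^sup>+y\<in>ball x r. w y \<partial>lebesgue) \<le> (\<integral>\<^sup>+y\<in>cball x r. w y \<partial>lebesgue)"
      by (intro nn_integral_mono) (auto split: split_indicator)
    also have "\<dots> < top" using assms(1) unfolding A_inf_def weight_def by auto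
    finally show ?thesis .
  qed
qed (use assms in auto)

text \<open>\<open>two_fat_weights\<close> uses one parameter for both weights; the smaller of the
  two from \<open>A_inf_fat\<close> works and depends only on \<open>a\<close> and
  \<open>b\<close>.\<close>

lemma A_inf_pair_fat:
  obtains \<delta> where "0 < \<delta>" "\<delta> < 1"
    "\<And>w Q. w \<in> A_inf \<Longrightarrow> A_inf_const w \<in> {a, b} \<Longrightarrow> Q \<in> cubes \<Longrightarrow>
      fat_on \<delta> (1 / (2 * 3 ^ CARD('n))) Q (w :: real ^ 'n \<Rightarrow> ennreal)"
    "\<And>w. w \<in> A_inf \<Longrightarrow> A_inf_const w \<in> {a, b} \<Longrightarrow> weight_fat_on_balls (w :: real ^ 'n \<Rightarrow> ennreal) \<delta>"
proof -
  let ?\<theta> = "1 / (2 * 3 ^ CARD('n)) :: real"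
  have \<theta>: "0 < ?\<theta>" by simp
  obtain \<delta>1 where 1: "0 < \<delta>1" "\<delta>1 < 1"
    "\<And>w Q. w \<in> A_inf \<Longrightarrow> A_inf_const w = a \<Longrightarrow> Q \<in> cubes \<Longrightarrow> fat_on \<delta>1 ?\<theta> Q (w :: real ^ 'n \<Rightarrow> ennreal)"
    "\<And>w x r. w \<in> A_inf \<Longrightarrow> A_inf_const w = a \<Longrightarrow> 0 < r \<Longrightarrow> fat_on \<delta>1 ?\<theta> (ball x r) (w :: real ^ 'n \<Rightarrow> ennreal)"
    using A_inf_fat[OF \<theta>, where ?'n = 'n and a = a] by blast
  obtain \<delta>2 where 2: "0 < \<delta>2" "\<delta>2 < 1"
    "\<And>w Q. w \<in> A_inf \<Longrightarrow> A_inf_const w = b \<Longrightarrow> Q \<in> cubes \<Longrightarrow> fat_on \<delta>2 ?\<theta> Q (w :: real ^ 'n \<Rightarrow> ennreal)"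
    "\<And>w x r. w \<in> A_inf \<Longrightarrow> A_inf_const w = b \<Longrightarrow> 0 < r \<Longrightarrow> fat_on \<delta>2 ?\<theta> (ball x r) (w :: real ^ 'n \<Rightarrow> ennreal)"
    using A_inf_fat[OF \<theta>, where ?'n = 'n and a = b] by blast
  define \<delta> where "\<delta> = min \<delta>1 \<delta>2"
  have \<delta>: "0 < \<delta>" "\<delta> < 1" unfolding \<delta>_def using 1 2 by auto
  have le: "\<delta> \<le> \<delta>1" "\<delta> \<le> \<delta>2" unfolding \<delta>_def by auto
  have meas: "w \<in> borel_measurable lebesgue" if "w \<in> A_inf" for w :: "real ^ 'n \<Rightarrow> ennreal"
    using that unfolding A_inf_def weight_def by auto
  show ?thesis
  proof (rule that[OF \<delta>])
    fix w :: "real ^ 'n \<Rightarrow> ennreal" assume w: "w \<in> A_inf" "A_inf_const w \<in> {a, b}"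
    show "fat_on \<delta> ?\<theta> Q w" if Q: "Q \<in> cubes" for Q
      using w(2) fat_on_mono[OF 1(3)[OF w(1) _ Q] le(1) order_refl meas[OF w(1)] cubes_measure(2)[OF Q]]
        fat_on_mono[OF 2(3)[OF w(1) _ Q] le(2) order_refl meas[OF w(1)] cubes_measure(2)[OF Q]] by blast
    show "weight_fat_on_balls w \<delta>"
    proof (rule A_inf_weight_fat_on_balls[OF w(1) \<delta>])
      fix x :: "real ^ 'n" and r :: real assume r: "0 < r"
      show "fat_on \<delta> ?\<theta> (ball x r) w"
        using w(2) fat_on_mono[OF 1(4)[OF w(1) _ r] le(1) order_refl meas[OF w(1)] ball_in_sets_lebesgue]
          fat_on_mono[OF 2(4)[OF w(1) _ r] le(2) order_refl meas[OF w(1)] ball_in_sets_lebesgue] by blast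
    qed
  qed
qed

theorem theorem1p1:
  fixes p q p' \<alpha> :: real
  assumes "1 < p" and "p \<le> q"
    and "0 \<le> \<alpha>" and "\<alpha> < real CARD('n::finite)"
    and "1 / q = 1 / p - \<alpha> / real CARD('n)"
    and "1 / p + 1 / p' = 1"
  shows "\<exists>C1 :: ennreal \<Rightarrow> ennreal \<Rightarrow> real.
    (\<forall>a b. 0 < C1 a b) \<and>
    (\<forall>(u :: real ^ 'n \<Rightarrow> ennreal) (v :: real ^ 'n \<Rightarrow> ennreal) (C0 :: real).
       u \<in> borel_measurable lebesgue \<and> v \<in> borel_measurable lebesgue \<and>
       u \<in> A_inf \<and> (\<lambda>x. epowr (v x) (- p' / p)) \<in> A_inf \<and>
       0 < C0 \<and>
       (AE x in lebesgue. epowr (u x) (1 / q) \<le> ennreal C0 * epowr (v x) (1 / p))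
       \<longrightarrow>
       (SUP Q\<in>cubes. epowr (avg Q u) (1 / q)
            * epowr (avg Q (\<lambda>x. epowr (v x) (- p' / p))) (1 / p')) < top \<and>
       (0 < \<alpha> \<longrightarrow>
          (\<forall>f :: real ^ 'n \<Rightarrow> complex. f \<in> borel_measurable lebesgue \<longrightarrow>
             weighted_norm q u (riesz_modulus \<alpha> f)
               \<le> ennreal (C0 * C1 (A_inf_const u) (A_inf_const (\<lambda>x. epowr (v x) (- p' / p))))
                  * weighted_norm p v (\<lambda>x. ennreal (cmod (f x))))) \<and>
       (\<alpha> = 0 \<longrightarrow>
          (\<forall>f :: real ^ 'n \<Rightarrow> complex. f \<in> borel_measurable lebesgue \<longrightarrow>
             weighted_norm q u (maximal f)
               \<le> ennreal (C0 * C1 (A_inf_const u) (A_inf_const (\<lambda>x. epowr (v x) (- p' / p))))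
                  * weighted_norm p v (\<lambda>x. ennreal (cmod (f x))))))"
proof -
  note conj = \<open>1 / p + 1 / p' = 1\<close>
  let ?n = "CARD('n)"
  have p: "0 < p" "0 < q" using assms by auto
  have "1 / p' = 1 - 1 / p" using conj by simp
  then have "0 < 1 / p'" "1 / p' < 1" using assms(1) by auto
  then have p': "0 < p'" "1 < p'" by (auto simp: divide_less_eq)
  \<comment> \<open>The scaling of the two-weight condition matches the exponent of the Riesz
    kernel.\<close>
  have \<gamma>: "real ?n * (1 / q + 1 / p') = real ?n - \<alpha>"
  proof -
    have "1 / q + 1 / p' = 1 - \<alpha> / real ?n" using assms(5) conj by linarith
    then show ?thesis by (simp add: field_simps)
  qed
  \<comment> \<open>The values \<open>a\<close> and \<open>b\<close> are fixed before the weights,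
    so one constant is found for each pair and the function \<open>C1\<close> is obtained by
    choice.\<close>
  define goal where "goal a b c \<longleftrightarrow> (\<forall>(u :: real ^ 'n \<Rightarrow> ennreal) (v :: real ^ 'n \<Rightarrow> ennreal) (C0 :: real).
       A_inf_const u = a \<and> A_inf_const (\<lambda>x. epowr (v x) (- p' / p)) = b \<and>
       u \<in> borel_measurable lebesgue \<and> v \<in> borel_measurable lebesgue \<and>
       u \<in> A_inf \<and> (\<lambda>x. epowr (v x) (- p' / p)) \<in> A_inf \<and> 0 < C0 \<and>
       (AE x in lebesgue. epowr (u x) (1 / q) \<le> ennreal C0 * epowr (v x) (1 / p))
       \<longrightarrow>
       (SUP Q\<in>cubes. epowr (avg Q u) (1 / q)
            * epowr (avg Q (\<lambda>x. epowr (v x) (- p' / p))) (1 / p')) < top \<and>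
       (0 < \<alpha> \<longrightarrow>
          (\<forall>f :: real ^ 'n \<Rightarrow> complex. f \<in> borel_measurable lebesgue \<longrightarrow>
             weighted_norm q u (riesz_modulus \<alpha> f)
               \<le> ennreal (C0 * c) * weighted_norm p v (\<lambda>x. ennreal (cmod (f x))))) \<and>
       (\<alpha> = 0 \<longrightarrow>
          (\<forall>f :: real ^ 'n \<Rightarrow> complex. f \<in> borel_measurable lebesgue \<longrightarrow>
             weighted_norm q u (maximal f)
               \<le> ennreal (C0 * c) * weighted_norm p v (\<lambda>x. ennreal (cmod (f x))))))" for a b c
  have "\<exists>c>0. goal a b c" for a b
  proof -
    obtain \<delta> where \<delta>: "0 < \<delta>" "\<delta> < 1" and
      cube: "\<And>w Q. w \<in> A_inf \<Longrightarrow> A_inf_const w \<in> {a, b} \<Longrightarrow> Q \<in> cubes \<Longrightarrow>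
        fat_on \<delta> (1 / (2 * 3 ^ ?n)) Q (w :: real ^ 'n \<Rightarrow> ennreal)" and
      balls: "\<And>w. w \<in> A_inf \<Longrightarrow> A_inf_const w \<in> {a, b} \<Longrightarrow> weight_fat_on_balls (w :: real ^ 'n \<Rightarrow> ennreal) \<delta>"
      using A_inf_pair_fat[where ?'n = 'n and a = a and b = b] by blast
    \<comment> \<open>The constants of \<open>maximal_weighted_bound\<close> and
      \<open>riesz_weighted_bound\<close> with the factor \<open>C0\<close> removed.\<close>
    define c where "c = (if \<alpha> = 0 then (1 + real ?n) ^ ?n
        else hedberg_const (1 - \<delta> / (2 * 3 ^ ?n)) (real ?n - \<alpha>) p q)
      * test_const ?n \<delta> p' q * op_const ?n \<delta> p p' q"
    have \<theta>: "4 * (1 / (2 * 3 ^ ?n)) \<le> (1 :: real)"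
    proof -
      have "(3 :: real) ^ 1 \<le> 3 ^ ?n" by (intro power_increasing) (auto simp: Suc_le_eq)
      then show ?thesis by (simp add: divide_le_eq)
    qed
    have pq: "p < q" if "\<alpha> \<noteq> 0"
    proof -
      have "1 / q < 1 / p" using assms(3,5) that by simp
      then show ?thesis using p by (simp add: field_simps)
    qed
    have c: "0 < c"
    proof -
      have "\<delta> / (2 * 3 ^ ?n) < 1" using \<delta> \<theta> by (simp add: divide_less_eq)
      then have "0 < (if \<alpha> = 0 then (1 + real ?n) ^ ?n else hedberg_const (1 - \<delta> / (2 * 3 ^ ?n)) (real ?n - \<alpha>) p q)"
        using pq p \<delta> by (auto intro!: hedberg_const_pos zero_less_power add_pos_nonneg)
      then show ?thesis unfolding c_def using \<delta> assms(1) p' by (intro mult_pos_pos test_const_pos op_const_pos)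
    qed
    have "goal a b c"
      unfolding goal_def
    proof (intro allI impI, elim conjE)
      fix u v :: "real ^ 'n \<Rightarrow> ennreal" and C0 :: real
      define \<sigma> where "\<sigma> = (\<lambda>x. epowr (v x) (- p' / p))"
      assume ab: "A_inf_const u = a" "A_inf_const (\<lambda>x. epowr (v x) (- p' / p)) = b"
        and [measurable]: "u \<in> borel_measurable lebesgue" "v \<in> borel_measurable lebesgue"
        and A: "u \<in> A_inf" "(\<lambda>x. epowr (v x) (- p' / p)) \<in> A_inf" and C0: "0 < C0"
        and uv: "AE x in lebesgue. epowr (u x) (1 / q) \<le> ennreal C0 * epowr (v x) (1 / p)"
      note ab' = ab(1) ab(2)[folded \<sigma>_def] and A' = A(1) A(2)[folded \<sigma>_def]
      have [measurable]: "\<sigma> \<in> borel_measurable lebesgue" unfolding \<sigma>_def by measurable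
      have bound: "AE x in lebesgue. epowr (u x) (1 / q) * epowr (\<sigma> x) (1 / p') \<le> ennreal C0"
        using uv unfolding \<sigma>_def by eventually_elim (rule dual_weight_le[OF p(1) p'(1) C0])
      have wu: "weight_fat_on_balls u \<delta>" and ws: "weight_fat_on_balls \<sigma> \<delta>"
        using balls A' ab' by auto
      have "epowr (avg Q u) (1 / q) * epowr (avg Q \<sigma>) (1 / p') \<le> ennreal (C0 * \<delta> powr - (1 / q + 1 / p'))"
        if Q: "Q \<in> cubes" for Q
        using A' ab' \<theta> cubes_measure[OF Q] \<delta> p p'
        by (intro fat_on_two_weight_bound[OF cube[OF _ _ Q] cube[OF _ _ Q] _ _ _ _ _ _ _ _ _ _ bound]) auto
      then have "(SUP Q\<in>cubes. epowr (avg Q u) (1 / q) * epowr (avg Q \<sigma>) (1 / p'))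
          \<le> ennreal (C0 * \<delta> powr - (1 / q + 1 / p'))" by (rule SUP_least)
      then have first: "(SUP Q\<in>cubes. epowr (avg Q u) (1 / q) * epowr (avg Q \<sigma>) (1 / p')) < top"
        using ennreal_less_top by (rule le_less_trans)
      have riesz: "weighted_norm q u (riesz_modulus \<alpha> f) \<le> ennreal (C0 * c) * weighted_norm p v (\<lambda>x. ennreal (cmod (f x)))"
        if \<alpha>: "0 < \<alpha>" and [measurable]: "f \<in> borel_measurable lebesgue" for f
      proof -
        define T where "T h x = (\<integral>\<^sup>+y. h y * ennreal (norm (x - y) powr - (real ?n - \<alpha>)) \<partial>lebesgue)"
          for h and x :: "real ^ 'n"
        have "weighted_norm q u (riesz_modulus \<alpha> f) \<le> weighted_norm q u (T (\<lambda>y. ennreal (cmod (f y))))"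
          unfolding weighted_norm_def T_def using p
          by (intro epowr_mono nn_integral_mono mult_right_mono riesz_modulus_le) auto
        also have "\<dots> \<le> ennreal (C0 * c) * weighted_norm p v (\<lambda>y. ennreal (cmod (f y)))"
        proof (rule reduce_to_dual_weight[OF wu ws \<sigma>_def])
          show "T h x = T h' x" if "AE y in lebesgue. h y = h' y" for h h' x
            unfolding T_def using that by (intro nn_integral_cong_AE) auto
        next
          fix g :: "real ^ 'n \<Rightarrow> ennreal"
          assume tw: "two_fat_weights u \<sigma> \<delta> p p'" and g: "g \<in> borel_measurable lebesgue"
          have "p < q" using pq \<alpha> by simp
          have eq: "C0 * c = hedberg_const (1 - \<delta> / (2 * 3 ^ ?n)) (real ?n - \<alpha>) p q
              * (C0 * test_const ?n \<delta> p' q) * op_const ?n \<delta> p p' q"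
            unfolding c_def using \<alpha> by simp
          show "epowr (\<integral>\<^sup>+x. epowr (T (\<lambda>y. g y * \<sigma> y) x) q * u x \<partial>lebesgue) (1 / q)
              \<le> ennreal (C0 * c) * epowr (\<integral>\<^sup>+x. epowr (g x) p \<partial>density lebesgue \<sigma>) (1 / p)"
            unfolding T_def eq
            using two_fat_weights.riesz_weighted_bound[OF tw g \<open>p < q\<close> C0 bound] unfolding \<gamma> .
        qed (use assms p C0 c in \<open>auto simp: T_def\<close>)
        finally show ?thesis .
      qed
      have maximal: "weighted_norm q u (maximal f) \<le> ennreal (C0 * c) * weighted_norm p v (\<lambda>x. ennreal (cmod (f x)))"
        if \<alpha>: "\<alpha> = 0" and [measurable]: "f \<in> borel_measurable lebesgue" for f
      proof -
        have qp: "q = p" using assms(5) \<alpha> p by (simp add: field_simps)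
        define T where "T h x = (SUP Q\<in>{Q \<in> cubes. x \<in> Q}. avg Q h)"
          for h and x :: "real ^ 'n"
        have "maximal f = T (\<lambda>y. ennreal (cmod (f y)))"
          unfolding T_def by (rule ext) (simp add: maximal_def)
        moreover have "weighted_norm q u (T (\<lambda>y. ennreal (cmod (f y))))
            \<le> ennreal (C0 * c) * weighted_norm p v (\<lambda>y. ennreal (cmod (f y)))"
        proof (rule reduce_to_dual_weight[OF wu ws \<sigma>_def])
          show "T h x = T h' x" if "AE y in lebesgue. h y = h' y" for h h' x
          proof -
            have "avg Q h = avg Q h'" for Q
              unfolding avg_def using that by (intro arg_cong2[where f="(/)"] nn_integral_cong_AE refl) auto
            then show ?thesis unfolding T_def by simp
          qed
          show "T (\<lambda>y. 0) x = 0" for x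
            unfolding T_def avg_def by (intro antisym SUP_least) simp_all
        next
          fix g :: "real ^ 'n \<Rightarrow> ennreal"
          assume tw: "two_fat_weights u \<sigma> \<delta> p p'" and g: "g \<in> borel_measurable lebesgue"
          have eq: "C0 * c = (1 + real ?n) ^ ?n * (C0 * test_const ?n \<delta> p' p) * op_const ?n \<delta> p p' p"
            unfolding c_def using \<alpha> qp by simp
          show "epowr (\<integral>\<^sup>+x. epowr (T (\<lambda>y. g y * \<sigma> y) x) q * u x \<partial>lebesgue) (1 / q)
              \<le> ennreal (C0 * c) * epowr (\<integral>\<^sup>+x. epowr (g x) p \<partial>density lebesgue \<sigma>) (1 / p)"
            unfolding T_def eq qp
            by (rule two_fat_weights.maximal_weighted_bound[OF tw g C0 bound[unfolded qp]])
        qed (use assms p C0 c in auto)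
        ultimately show ?thesis by simp
      qed
      show "(SUP Q\<in>cubes. epowr (avg Q u) (1 / q) * epowr (avg Q (\<lambda>x. epowr (v x) (- p' / p))) (1 / p')) < top \<and>
        (0 < \<alpha> \<longrightarrow> (\<forall>f :: real ^ 'n \<Rightarrow> complex. f \<in> borel_measurable lebesgue \<longrightarrow>
          weighted_norm q u (riesz_modulus \<alpha> f) \<le> ennreal (C0 * c) * weighted_norm p v (\<lambda>x. ennreal (cmod (f x))))) \<and>
        (\<alpha> = 0 \<longrightarrow> (\<forall>f :: real ^ 'n \<Rightarrow> complex. f \<in> borel_measurable lebesgue \<longrightarrow>
          weighted_norm q u (maximal f) \<le> ennreal (C0 * c) * weighted_norm p v (\<lambda>x. ennreal (cmod (f x)))))"
        using first riesz maximal unfolding \<sigma>_def by blast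
    qed
    then show ?thesis using c by blast
  qed
  then obtain C1 where "\<And>a b. 0 < C1 a b \<and> goal a b (C1 a b)" by metis
  then show ?thesis unfolding goal_def by (intro exI[of _ C1]) blast
qed

end
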